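(* Let $K$ be a field of characteristic zero and let $M$ be a holonomic left module over the Weyl algebra $A_n(K)$. Then $H^i(\partial_1,\ldots,\partial_n;M)=0$ for all $i<n-\dim M$.
   Context: $A_n(K)=K\langle X_1,\ldots,X_n,\partial_1,\ldots,\partial_n\rangle$, containing $R=K[X_1,\ldots,X_n]$. $\dim M$ denotes the dimension of the support of $M$ regarded as an $R$-module (with $\dim 0=-\infty$). $H^i(\partial_1,\ldots,\partial_n;M)$ is the $i$-th cohomology of the De Rham complex of $M$, i.e. of the Koszul cochain complex of $M$ with respect to the commuting $K$-linear maps $\partial_1,\ldots,\partial_n$ (so $H^0$ is the common kernel and $H^n=M/\sum_j\partial_jM$). *)

theory Defs
  imports "HOL-Library.Poly_Mapping" "HOL-Library.Extended_Real"
begin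

text \<open>A left module over the Weyl algebra A_n(K), with the variables indexed by a
finite linearly ordered type 'n (so n = CARD('n)), is given by a K-vector space
structure (scalar action sc on an abelian group 'm) together with K-linear operators
X i (multiplication by X_i) and D i (action of the derivation symbol) satisfying the
defining relations of the Weyl algebra.\<close>

definition weyl_module ::
  "('k::field \<Rightarrow> 'm::ab_group_add \<Rightarrow> 'm) \<Rightarrow> ('n \<Rightarrow> 'm \<Rightarrow> 'm) \<Rightarrow> ('n \<Rightarrow> 'm \<Rightarrow> 'm) \<Rightarrow> bool" where
  "weyl_module sc X D \<longleftrightarrow>
     (\<forall>a b x y. sc a (x + y) = sc a x + sc a y \<and> sc (a + b) x = sc a x + sc b x
        \<and> sc a (sc b x) = sc (a * b) x \<and> sc 1 x = x) \<and>
     (\<forall>i a x y. X i (x + y) = X i x + X i y \<and> X i (sc a x) = sc a (X i x)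
        \<and> D i (x + y) = D i x + D i y \<and> D i (sc a x) = sc a (D i x)) \<and>
     (\<forall>i j x. X i (X j x) = X j (X i x) \<and> D i (D j x) = D j (D i x)
        \<and> D i (X j x) - X j (D i x) = (if i = j then x else 0))"

inductive_set kspan :: "('k \<Rightarrow> 'm::ab_group_add \<Rightarrow> 'm) \<Rightarrow> 'm set \<Rightarrow> 'm set"
  for sc :: "'k \<Rightarrow> 'm \<Rightarrow> 'm" and S :: "'m set" where
  kspan_zero: "0 \<in> kspan sc S"
| kspan_base: "v \<in> S \<Longrightarrow> v \<in> kspan sc S"
| kspan_add: "v \<in> kspan sc S \<Longrightarrow> w \<in> kspan sc S \<Longrightarrow> v + w \<in> kspan sc S"
| kspan_smult: "v \<in> kspan sc S \<Longrightarrow> sc c v \<in> kspan sc S"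

text \<open>Bernstein filtration generated by a set G: F_k = span of X^a D^b g with |a|+|b| <= k.\<close>
fun bern_filt :: "('k \<Rightarrow> 'm::ab_group_add \<Rightarrow> 'm) \<Rightarrow> ('n \<Rightarrow> 'm \<Rightarrow> 'm) \<Rightarrow> ('n \<Rightarrow> 'm \<Rightarrow> 'm)
      \<Rightarrow> 'm set \<Rightarrow> nat \<Rightarrow> 'm set" where
  "bern_filt sc X D G 0 = kspan sc G"
| "bern_filt sc X D G (Suc k) =
     kspan sc (bern_filt sc X D G k \<union> (\<Union>i. X i ` bern_filt sc X D G k)
                                   \<union> (\<Union>i. D i ` bern_filt sc X D G k))"

text \<open>Holonomic: finitely generated, and the Bernstein filtration has growth
dim_K F_k <= C (k+1)^n, i.e. Gelfand-Kirillov / Bernstein dimension d(M) <= n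
(by Bernstein's inequality, d(M) = n or M = 0). "dim_K F_k <= N" is expressed as
"F_k is contained in the span of at most N vectors".\<close>
definition holonomic :: "('k::field \<Rightarrow> 'm::ab_group_add \<Rightarrow> 'm) \<Rightarrow> ('n::finite \<Rightarrow> 'm \<Rightarrow> 'm)
      \<Rightarrow> ('n \<Rightarrow> 'm \<Rightarrow> 'm) \<Rightarrow> bool" where
  "holonomic sc X D \<longleftrightarrow> weyl_module sc X D \<and>
     (\<exists>G. finite G \<and> (\<Union>k. bern_filt sc X D G k) = UNIV \<and>
        (\<exists>C::real. \<forall>k. \<exists>vs. real (length vs) \<le> C * (real k + 1) ^ card (UNIV :: 'n set)
                        \<and> bern_filt sc X D G k \<subseteq> kspan sc (set vs)))"

text \<open>R = K[X_i : i in 'n] as poly_mapping (monomials are finitely supported exponent maps), acting on M.\<close>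
definition xmono :: "('n::{finite,linorder} \<Rightarrow> 'm \<Rightarrow> 'm) \<Rightarrow> ('n \<Rightarrow>\<^sub>0 nat) \<Rightarrow> 'm \<Rightarrow> 'm" where
  "xmono X a m = foldr (\<lambda>i. X i ^^ Poly_Mapping.lookup a i) (sorted_list_of_set UNIV) m"

definition poly_act :: "('k::field \<Rightarrow> 'm::ab_group_add \<Rightarrow> 'm) \<Rightarrow> ('n::{finite,linorder} \<Rightarrow> 'm \<Rightarrow> 'm)
      \<Rightarrow> (('n \<Rightarrow>\<^sub>0 nat) \<Rightarrow>\<^sub>0 'k) \<Rightarrow> 'm \<Rightarrow> 'm" where
  "poly_act sc X p m = (\<Sum>a\<in>Poly_Mapping.keys p. sc (Poly_Mapping.lookup p a) (xmono X a m))"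

definition prime_ideal :: "'a::comm_ring_1 set \<Rightarrow> bool" where
  "prime_ideal P \<longleftrightarrow> 0 \<in> P \<and> P \<noteq> UNIV \<and> (\<forall>x\<in>P. \<forall>y\<in>P. x + y \<in> P)
     \<and> (\<forall>r. \<forall>x\<in>P. r * x \<in> P) \<and> (\<forall>x y. x * y \<in> P \<longrightarrow> x \<in> P \<or> y \<in> P)"

text \<open>Support of M as an R-module: primes P with M_P \<noteq> 0, i.e. some m with m/1 \<noteq> 0 in M_P,
i.e. s m \<noteq> 0 for all s \<notin> P.\<close>
definition R_support :: "('k::field \<Rightarrow> 'm::ab_group_add \<Rightarrow> 'm) \<Rightarrow> ('n::{finite,linorder} \<Rightarrow> 'm \<Rightarrow> 'm)
      \<Rightarrow> ((('n \<Rightarrow>\<^sub>0 nat) \<Rightarrow>\<^sub>0 'k) set) set" where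
  "R_support sc X = {P. prime_ideal P \<and> (\<exists>m. \<forall>s. s \<notin> P \<longrightarrow> poly_act sc X s m \<noteq> 0)}"

text \<open>Krull dimension of the support (supremum of lengths of strict chains of primes in
the support); -\<infinity> for the empty support (M = 0).\<close>
definition supp_dim :: "('k::field \<Rightarrow> 'm::ab_group_add \<Rightarrow> 'm) \<Rightarrow> ('n::{finite,linorder} \<Rightarrow> 'm \<Rightarrow> 'm) \<Rightarrow> ereal" where
  "supp_dim sc X = (if R_support sc X = {} then -\<infinity> else
     Sup {ereal (real (length cs) - 1) | cs. cs \<noteq> [] \<and> set cs \<subseteq> R_support sc X
                                          \<and> sorted_wrt (\<lambda>A B. A \<subset> B) cs})"

text \<open>De Rham (Koszul cochain) complex: an i-cochain is \<omega> : 'n set \<Rightarrow> M supported on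
index sets of cardinality i (coefficient of e_J).\<close>
definition cochain :: "nat \<Rightarrow> ('n::finite set \<Rightarrow> 'm::zero) \<Rightarrow> bool" where
  "cochain i \<omega> \<longleftrightarrow> (\<forall>J. card J \<noteq> i \<longrightarrow> \<omega> J = 0)"

definition dR_diff :: "('n::{finite,linorder} \<Rightarrow> 'm \<Rightarrow> 'm) \<Rightarrow> ('n set \<Rightarrow> 'm::ab_group_add)
      \<Rightarrow> 'n set \<Rightarrow> 'm" where
  "dR_diff D \<omega> J = (\<Sum>j\<in>J. (if even (card {l\<in>J. l < j}) then D j (\<omega> (J - {j}))
                                                     else - D j (\<omega> (J - {j}))))"

definition deRham_vanishes :: "('n::{finite,linorder} \<Rightarrow> 'm::ab_group_add \<Rightarrow> 'm) \<Rightarrow> nat \<Rightarrow> bool" where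
  "deRham_vanishes D i \<longleftrightarrow>
     (\<forall>\<omega>. cochain i \<omega> \<and> dR_diff D \<omega> = (\<lambda>_. 0) \<longrightarrow>
        (if i = 0 then \<omega> = (\<lambda>_. 0) else (\<exists>\<eta>. cochain (i - 1) \<eta> \<and> dR_diff D \<eta> = \<omega>)))"

end

theory Submission
  imports Defs "HOL-Computational_Algebra.Polynomial"
begin

text \<open>Let G be a finite generating set of M and I the annihilator of
  G in the polynomial ring R; every element of I acts locally nilpotently on M. Choose directions
  w1, w2, ... one after the other: as long as I contains a nonzero f that is constant along the
  previous directions, take w such that some iterated derivative of f along w is a nonzero
  constant (f is monic in the direction w). Differentiating f^t m = 0 shows that the derivation
  D_w is injective on M modulo the images of the previous ones, so these derivations form an
  M-regular sequence in the span of the D_i. Contraction with w is a homotopy between D_w and 0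
  on the De Rham complex, hence H^i vanishes for i less than the number c of directions.

  When the process stops with c < n, the ring S of polynomials constant along all directions
  meets I in 0, and R is finite over S modulo I because the chosen elements are monic. S is a
  polynomial ring in at least n - c variables, and lying over lifts a chain of n - c + 1 primes
  of S to primes of R containing I. These belong to the support, so c is at least n - dim M.\<close>

section \<open>Induction principles for polynomials\<close>

type_synonym ('n, 'k) mpol = "('n \<Rightarrow>\<^sub>0 nat) \<Rightarrow>\<^sub>0 'k"

abbreviation Cst :: "'k::zero \<Rightarrow> ('n, 'k) mpol" where
  "Cst c \<equiv> Poly_Mapping.single 0 c"

abbreviation Var :: "'n \<Rightarrow> ('n, 'k::zero_neq_one) mpol" where
  "Var i \<equiv> Poly_Mapping.single (Poly_Mapping.single i (Suc 0)) 1"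

lemma poly_mapping_add_induct [case_names zero single add]:
  fixes p :: "'a \<Rightarrow>\<^sub>0 'b::comm_monoid_add"
  assumes zero: "P 0" and single: "\<And>a c. P (Poly_Mapping.single a c)"
    and add: "\<And>p q. P p \<Longrightarrow> P q \<Longrightarrow> P (p + q)"
  shows "P p"
proof (induction p rule: update_induct)
  case const
  show ?case by (rule zero)
next
  case (update f a b)
  have "Poly_Mapping.update a b f = f + Poly_Mapping.single a b"
    using update(1)
    by (intro poly_mapping_eqI)
       (auto simp: lookup_update lookup_add lookup_single when_def in_keys_iff)
  then show ?case using add single update by metis
qed

text \<open>Homomorphism and derivation identities are preserved by sums and products, so this rule
  leaves only constants and variables to check.\<close>

lemma mpol_induct [case_names Cst Var add mult]:
  fixes p :: "('n, 'k::comm_semiring_1) mpol"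
  assumes Cst: "\<And>c. P (Cst c)" and Var: "\<And>i. P (Var i)"
    and add: "\<And>p q. P p \<Longrightarrow> P q \<Longrightarrow> P (p + q)"
    and mult: "\<And>p q. P p \<Longrightarrow> P q \<Longrightarrow> P (p * q)"
  shows "P p"
proof -
  have pow: "P (Poly_Mapping.single (Poly_Mapping.single i k) 1)" for i k
  proof (induction k)
    case 0
    then show ?case using Cst[of 1] by simp
  next
    case (Suc k)
    have "Poly_Mapping.single (Poly_Mapping.single i (Suc k)) (1::'k) =
      Var i * Poly_Mapping.single (Poly_Mapping.single i k) 1"
      by (simp add: mult_single flip: single_add)
    then show ?case using mult Var Suc by metis
  qed
  have mon: "P (Poly_Mapping.single a 1)" for a
  proof (induction a rule: poly_mapping_add_induct)
    case zero
    show ?case using Cst[of 1] .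
  next
    case (single i k)
    show ?case by (rule pow)
  next
    case (add a b)
    have "Poly_Mapping.single (a + b) (1::'k) = Poly_Mapping.single a 1 * Poly_Mapping.single b 1"
      by (simp add: mult_single)
    then show ?case using mult add by metis
  qed
  show ?thesis
  proof (induction p rule: poly_mapping_add_induct)
    case zero
    show ?case using Cst[of 0] by simp
  next
    case (single a c)
    have "Poly_Mapping.single a c = Cst c * Poly_Mapping.single a 1"
      by (simp add: mult_single)
    then show ?case using mult Cst mon by metis
  next
    case (add p q)
    then show ?case by (rule assms(3))
  qed
qed

section \<open>Polynomials acting through commuting operators\<close>

text \<open>Derivations are left out so that the polynomial ring itself is an instance, with
  \<open>X i\<close> acting as multiplication by a chosen polynomial; this yields
  \<open>subst\<close>.\<close>

locale commuting_operators =
  fixes sc :: "'k::field \<Rightarrow> 'm::ab_group_add \<Rightarrow> 'm"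
    and X :: "'n::{finite,linorder} \<Rightarrow> 'm \<Rightarrow> 'm"
  assumes sc_add_right: "sc a (x + y) = sc a x + sc a y"
    and sc_add_left: "sc (a + b) x = sc a x + sc b x"
    and sc_sc: "sc a (sc b x) = sc (a * b) x"
    and sc_one [simp]: "sc 1 x = x"
    and X_add: "X i (x + y) = X i x + X i y"
    and X_sc: "X i (sc a x) = sc a (X i x)"
    and X_commute: "X i (X j x) = X j (X i x)"
begin

abbreviation act :: "('n, 'k) mpol \<Rightarrow> 'm \<Rightarrow> 'm" where
  "act \<equiv> poly_act sc X"

lemma sc_zero_left [simp]: "sc 0 x = 0"
  using sc_add_left[of 0 0 x] by simp

lemma sc_zero_right [simp]: "sc a 0 = 0"
  using sc_add_right[of a 0 0] by simp

lemma sc_minus_one [simp]: "sc (- 1) x = - x"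
  using sc_add_left[of 1 "- 1" x] by (simp add: eq_neg_iff_add_eq_0 add.commute)

lemma X_pow_add: "(X i ^^ k) (x + y) = (X i ^^ k) x + (X i ^^ k) y"
  by (induction k) (simp_all add: X_add)

lemma X_pow_sc: "(X i ^^ k) (sc a x) = sc a ((X i ^^ k) x)"
  by (induction k) (simp_all add: X_sc)

lemma X_pow_commute: "(X i ^^ k) ((X j ^^ l) x) = (X j ^^ l) ((X i ^^ k) x)"
proof (induction k)
  case (Suc k)
  have "X i ((X j ^^ l) z) = (X j ^^ l) (X i z)" for z
    using X_commute by (induction l) (simp_all add: X_commute[of i j])
  then show ?case using Suc by simp
qed simp

lemma foldr_X_add:
  "foldr (\<lambda>i. X i ^^ f i) xs (x + y) = foldr (\<lambda>i. X i ^^ f i) xs x + foldr (\<lambda>i. X i ^^ f i) xs y"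
  by (induction xs) (simp_all add: X_pow_add)

lemma foldr_X_sc:
  "foldr (\<lambda>i. X i ^^ f i) xs (sc a x) = sc a (foldr (\<lambda>i. X i ^^ f i) xs x)"
  by (induction xs) (simp_all add: X_pow_sc)

lemma foldr_X_pow:
  "foldr (\<lambda>i. X i ^^ f i) xs ((X j ^^ k) x) = (X j ^^ k) (foldr (\<lambda>i. X i ^^ f i) xs x)"
  by (induction xs) (simp_all add: X_pow_commute)

lemma foldr_X_plus:
  "foldr (\<lambda>i. X i ^^ (f i + g i)) xs x
     = foldr (\<lambda>i. X i ^^ f i) xs (foldr (\<lambda>i. X i ^^ g i) xs x)"
  by (induction xs) (simp_all add: foldr_X_pow funpow_add)

lemma xmono_add_right: "xmono X a (x + y) = xmono X a x + xmono X a y"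
  by (simp add: xmono_def foldr_X_add)

lemma xmono_sc: "xmono X a (sc c x) = sc c (xmono X a x)"
  by (simp add: xmono_def foldr_X_sc)

lemma xmono_add: "xmono X (a + b) x = xmono X a (xmono X b x)"
  by (simp add: xmono_def foldr_X_plus lookup_add)

lemma xmono_zero [simp]: "xmono X 0 x = x"
proof -
  have "foldr (\<lambda>i. X i ^^ 0) xs x = x" for xs
    by (induction xs) simp_all
  then show ?thesis by (simp add: xmono_def)
qed

lemma foldr_X_single:
  "distinct xs \<Longrightarrow> foldr (\<lambda>i. X i ^^ (Suc 0 when j = i)) xs x = (if j \<in> set xs then X j x else x)"
  by (induction xs) (auto simp: when_def)

lemma xmono_single: "xmono X (Poly_Mapping.single j (Suc 0)) x = X j x"
  using foldr_X_single[of "sorted_list_of_set UNIV" j x]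
  by (simp add: xmono_def lookup_single)

lemma act_single: "act (Poly_Mapping.single a c) x = sc c (xmono X a x)"
  by (simp add: poly_act_def)

lemma act_Cst [simp]: "act (Cst c) x = sc c x"
  by (simp add: act_single)

lemma act_zero [simp]: "act 0 x = 0"
  by (simp add: poly_act_def)

lemma act_one [simp]: "act 1 x = x"
  using act_Cst[of 1 x] by simp

lemma act_Var [simp]: "act (Var i) x = X i x"
  by (simp only: act_single xmono_single sc_one)

lemma act_add: "act (p + q) x = act p x + act q x"
  unfolding poly_act_def by (rule setsum_keys_plus_distrib) (simp_all add: sc_add_left)

lemma act_add_right: "act p (x + y) = act p x + act p y"
  by (simp add: poly_act_def xmono_add_right sc_add_right sum.distrib)

lemma act_zero_right [simp]: "act p 0 = 0"
  using act_add_right[of p 0 0] by simp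

text \<open>Both sides are additive in \<open>p\<close> and in \<open>q\<close>, which reduces the
  claim to monomials, where it is \<open>xmono_add\<close>.\<close>

lemma act_mult: "act (p * q) x = act p (act q x)"
proof (induction p rule: poly_mapping_add_induct)
  case (single a c)
  show ?case
  proof (induction q rule: poly_mapping_add_induct)
    case (single b d)
    show ?case
      by (simp add: act_single mult_single xmono_add xmono_sc sc_sc)
  qed (simp_all add: distrib_left act_add act_add_right)
qed (simp_all add: distrib_right act_add)

lemma act_commute: "act p (act q x) = act q (act p x)"
  by (simp add: mult.commute flip: act_mult)

lemma act_sc: "act p (sc c x) = sc c (act p x)"
  using act_commute[of p "Cst c" x] by simp

end

section \<open>Substitution\<close>

text \<open>The ring endomorphism with \<open>Var i\<close> \<mapsto> \<open>b i\<close>, obtained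
  by letting \<open>p\<close> act on 1 in the module where \<open>X i\<close> multiplies by
  \<open>b i\<close>.\<close>

definition subst :: "('n \<Rightarrow> ('n::{finite,linorder}, 'k::field) mpol) \<Rightarrow> ('n, 'k) mpol \<Rightarrow> ('n, 'k) mpol" where
  "subst b p = poly_act (\<lambda>c q. Cst c * q) (\<lambda>i q. b i * q) p 1"

lemma commuting_operators_mult:
  "commuting_operators (\<lambda>c q. Cst c * q) (\<lambda>i q. (b :: 'n \<Rightarrow> ('n::{finite,linorder}, 'k::field) mpol) i * q)"
  by unfold_locales (simp_all add: algebra_simps single_add mult_single)

lemma
  fixes b :: "'n \<Rightarrow> ('n::{finite,linorder}, 'k::field) mpol"
  shows subst_add: "subst b (p + q) = subst b p + subst b q"
    and subst_mult: "subst b (p * q) = subst b p * subst b q"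
    and subst_Cst [simp]: "subst b (Cst c) = Cst c"
    and subst_Var [simp]: "subst b (Var i) = b i"
proof -
  interpret commuting_operators "\<lambda>c q. Cst c * q" "\<lambda>i q. b i * q"
    by (rule commuting_operators_mult)
  \<comment> \<open>The action commutes with multiplication in the ring, so its value at 1
    determines it; this makes \<open>subst\<close> multiplicative.\<close>
  have *: "act p q = act p 1 * q" for p q
  proof (induction p arbitrary: q rule: mpol_induct)
    case (add p1 p2)
    show ?case by (simp only: act_add add[of q] distrib_right)
  next
    case (mult p1 p2)
    show ?case by (simp only: act_mult mult(2)[of q] mult(1)[of "act p2 1 * q"] mult(1)[of "act p2 1"] mult.assoc)
  qed simp_all
  show "subst b (p + q) = subst b p + subst b q" by (simp add: subst_def act_add)
  show "subst b (p * q) = subst b p * subst b q" 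
    unfolding subst_def by (metis act_mult *)
  show "subst b (Cst c) = Cst c" by (simp add: subst_def)
  show "subst b (Var i) = b i" by (simp add: subst_def)
qed

section \<open>Partial and directional derivatives\<close>

text \<open>The formal partial derivative, given by its coefficients. Its support is finite because
  the shift of exponents is injective.\<close>

lift_definition pd :: "'n \<Rightarrow> ('n, 'k::semiring_1) mpol \<Rightarrow> ('n, 'k) mpol" is
  "\<lambda>i p a. of_nat (Suc (Poly_Mapping.lookup a i)) * p (a + Poly_Mapping.single i 1)"
proof -
  fix i :: 'n and p :: "('n \<Rightarrow>\<^sub>0 nat) \<Rightarrow> 'k"
  assume "finite {a. p a \<noteq> 0}"
  then have "finite ((\<lambda>a. a + Poly_Mapping.single i 1) -` {a. p a \<noteq> 0})"
    by (rule finite_vimageI) (simp add: inj_on_def)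
  then show "finite {a. of_nat (Suc (Poly_Mapping.lookup a i)) * p (a + Poly_Mapping.single i 1) \<noteq> 0}"
    by (rule rev_finite_subset) auto
qed

lemma lookup_pd: "Poly_Mapping.lookup (pd i p) a =
    of_nat (Suc (Poly_Mapping.lookup a i)) * Poly_Mapping.lookup p (a + Poly_Mapping.single i 1)"
  by transfer simp

lemma pd_add: "pd i (p + q) = pd i p + pd i q"
  by (rule poly_mapping_eqI) (simp add: lookup_pd lookup_add distrib_left)

lemma pd_commute:
  fixes p :: "('n, 'k::comm_semiring_1) mpol"
  shows "pd i (pd j p) = pd j (pd i p)"
proof (cases "i = j")
  case False
  then show ?thesis
    by (intro poly_mapping_eqI)
       (simp add: lookup_pd lookup_add lookup_single algebra_simps)
qed simp

lemma diff_single_add: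
  fixes a :: "'n \<Rightarrow>\<^sub>0 nat"
  assumes "Poly_Mapping.lookup a i \<noteq> 0"
  shows "a - Poly_Mapping.single i 1 + Poly_Mapping.single i 1 = a"
  using assms
  by (intro poly_mapping_eqI) (auto simp: lookup_add lookup_minus lookup_single when_def)

text \<open>Subtraction of exponents is truncated, which is harmless: where it truncates, the
  coefficient on the right is zero.\<close>

lemma pd_single: "pd i (Poly_Mapping.single a c) =
    Poly_Mapping.single (a - Poly_Mapping.single i 1) (of_nat (Poly_Mapping.lookup a i) * c)"
proof (rule poly_mapping_eqI)
  fix b
  consider (eq) "a = b + Poly_Mapping.single i 1"
    | (z) "a \<noteq> b + Poly_Mapping.single i 1" "Poly_Mapping.lookup a i = 0"
    | (nz) "a \<noteq> b + Poly_Mapping.single i 1" "Poly_Mapping.lookup a i \<noteq> 0"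
    by blast
  then show "Poly_Mapping.lookup (pd i (Poly_Mapping.single a c)) b = Poly_Mapping.lookup
      (Poly_Mapping.single (a - Poly_Mapping.single i 1) (of_nat (Poly_Mapping.lookup a i) * c)) b"
  proof cases
    case eq
    then show ?thesis by (simp add: lookup_pd lookup_add)
  next
    case z
    then show ?thesis by (simp add: lookup_pd lookup_single_not_eq)
  next
    case nz
    then have "a - Poly_Mapping.single i 1 \<noteq> b"
      using diff_single_add by fastforce
    then show ?thesis using nz by (simp add: lookup_pd lookup_single_not_eq)
  qed
qed

lemma pd_zero [simp]: "pd i 0 = 0"
  by (rule poly_mapping_eqI) (simp add: lookup_pd)

lemma pd_mult:
  fixes p q :: "('n, 'k::comm_semiring_1) mpol"
  shows "pd i (p * q) = pd i p * q + p * pd i q"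
proof (induction p rule: poly_mapping_add_induct)
  case (single a c)
  show ?case
  proof (induction q rule: poly_mapping_add_induct)
    case (single b d)
    let ?e = "Poly_Mapping.single i (1::nat)"
    \<comment> \<open>The two exponents can differ only when the coefficient contains the factor
      0.\<close>
    have 1: "Poly_Mapping.single (a - ?e + b) (of_nat (Poly_Mapping.lookup a i) * c * d)
      = Poly_Mapping.single (a + b - ?e) (of_nat (Poly_Mapping.lookup a i) * c * d)"
    proof (cases "Poly_Mapping.lookup a i = 0")
      case False
      then have "a - ?e + b = a + b - ?e"
        by (intro poly_mapping_eqI) (auto simp: lookup_add lookup_minus lookup_single when_def)
      then show ?thesis by simp
    qed simp
    have 2: "Poly_Mapping.single (a + (b - ?e)) (c * (of_nat (Poly_Mapping.lookup b i) * d))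
      = Poly_Mapping.single (a + b - ?e) (c * (of_nat (Poly_Mapping.lookup b i) * d))"
    proof (cases "Poly_Mapping.lookup b i = 0")
      case False
      then have "a + (b - ?e) = a + b - ?e"
        by (intro poly_mapping_eqI) (auto simp: lookup_add lookup_minus lookup_single when_def)
      then show ?thesis by simp
    qed simp
    show ?case
      unfolding mult_single pd_single 1 2
      by (simp add: lookup_add algebra_simps flip: single_add)
  qed (simp_all add: distrib_left pd_add algebra_simps)
qed (simp_all add: distrib_right pd_add algebra_simps)

definition dird :: "('n::finite \<Rightarrow> 'k) \<Rightarrow> ('n, 'k::comm_ring_1) mpol \<Rightarrow> ('n, 'k) mpol" where
  "dird w p = (\<Sum>i\<in>UNIV. Cst (w i) * pd i p)"

lemma pd_Cst [simp]: "pd i (Cst c) = 0"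
  by (simp add: pd_single)

lemma pd_Var: "pd i (Var j) = (if i = j then 1 else 0)"
  by (auto simp: pd_single lookup_single)

lemma dird_add: "dird w (p + q) = dird w p + dird w q"
  by (simp add: dird_def pd_add distrib_left sum.distrib)

lemma dird_zero [simp]: "dird w 0 = 0"
  by (simp add: dird_def)

lemma dird_mult: "dird w (p * q) = dird w p * q + p * dird w q"
  by (simp add: dird_def pd_mult distrib_left sum.distrib sum_distrib_left sum_distrib_right ac_simps)

lemma dird_Cst [simp]: "dird w (Cst c) = 0"
  by (simp add: dird_def)

lemma dird_Cst_mult: "dird w (Cst c * p) = Cst c * dird w p"
  by (simp add: dird_mult)

lemma dird_minus: "dird w (- p) = - dird w p"
  using dird_add[of w p "- p"] by (simp add: eq_neg_iff_add_eq_0 add.commute)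

lemma dird_diff: "dird w (p - q) = dird w p - dird w q"
  using dird_add[of w p "- q"] by (simp add: dird_minus)

lemma pd_sum: "pd i (sum f A) = (\<Sum>x\<in>A. pd i (f x))"
  by (induction A rule: infinite_finite_induct) (simp_all add: pd_add)

lemma dird_commute: "dird v (dird w p) = dird w (dird v p)"
proof -
  have "dird v (dird w p) = (\<Sum>i\<in>UNIV. \<Sum>j\<in>UNIV. Cst (v i) * (Cst (w j) * pd i (pd j p)))"
    by (simp add: dird_def pd_sum pd_mult sum_distrib_left)
  also have "\<dots> = (\<Sum>j\<in>UNIV. \<Sum>i\<in>UNIV. Cst (v i) * (Cst (w j) * pd i (pd j p)))"
    by (rule sum.swap)
  also have "\<dots> = dird w (dird v p)"
    by (simp add: dird_def pd_sum pd_mult sum_distrib_left pd_commute ac_simps)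
  finally show ?thesis .
qed

lemma dird_pow_commute: "(dird v ^^ k) (dird w p) = dird w ((dird v ^^ k) p)"
  by (induction k) (simp_all add: dird_commute)

lemma dird_axis: "dird (\<lambda>j. if j = i then 1 else 0) p = pd i p"
proof -
  have "dird (\<lambda>j. if j = i then 1 else 0) p = (\<Sum>j\<in>UNIV. if j = i then pd j p else 0)"
    unfolding dird_def by (rule sum.cong) auto
  then show ?thesis by simp
qed

text \<open>With a strict bound, \<open>N = 0\<close> singles out the zero polynomial, and no
  convention for its degree is required.\<close>

definition deg_less :: "('n::finite, 'k::zero) mpol \<Rightarrow> nat \<Rightarrow> bool" where
  "deg_less p N \<longleftrightarrow> (\<forall>a\<in>Poly_Mapping.keys p. (\<Sum>i\<in>UNIV. Poly_Mapping.lookup a i) < N)"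

lemma sum_lookup_add_single:
  "(\<Sum>j\<in>UNIV. Poly_Mapping.lookup (a + Poly_Mapping.single i 1) j)
     = Suc (\<Sum>j\<in>(UNIV :: 'n::finite set). Poly_Mapping.lookup a j)"
  by (simp add: lookup_add sum.distrib lookup_single when_def)

lemma deg_less_0: "deg_less p 0 \<longleftrightarrow> p = 0"
  by (simp add: deg_less_def flip: keys_eq_empty)

lemma ex_deg_less: "\<exists>N. deg_less p N"
proof -
  have "finite ((\<lambda>a. \<Sum>i\<in>UNIV. Poly_Mapping.lookup a i) ` Poly_Mapping.keys p)"
    by simp
  then show ?thesis
    unfolding deg_less_def finite_nat_set_iff_bounded by auto
qed

lemma deg_less_1_iff: "deg_less p (Suc 0) \<longleftrightarrow> p = Cst (Poly_Mapping.lookup p 0)"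
proof
  assume *: "deg_less p (Suc 0)"
  show "p = Cst (Poly_Mapping.lookup p 0)"
  proof (rule poly_mapping_eqI)
    fix a :: "'a \<Rightarrow>\<^sub>0 nat"
    show "Poly_Mapping.lookup p a = Poly_Mapping.lookup (Cst (Poly_Mapping.lookup p 0)) a"
    proof (cases "a \<in> Poly_Mapping.keys p")
      case True
      with * have "a = 0"
        by (auto simp: deg_less_def intro: poly_mapping_eqI)
      then show ?thesis by simp
    next
      case False
      then show ?thesis
        by (cases "a = 0") (simp_all add: in_keys_iff lookup_single)
    qed
  qed
next
  assume "p = Cst (Poly_Mapping.lookup p 0)"
  then have "Poly_Mapping.keys p \<subseteq> {0}"
    by (metis keys_single empty_subsetI subset_refl)
  then show "deg_less p (Suc 0)"
    by (auto simp: deg_less_def)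
qed

lemma lookup_Cst_mult:
  fixes p :: "('n, 'k::semiring_0) mpol"
  shows "Poly_Mapping.lookup (Cst c * p) a = c * Poly_Mapping.lookup p a"
  unfolding mult_map_scale_conv_mult[symmetric] by (simp add: map.rep_eq when_def)

lemma deg_less_dird:
  assumes "deg_less p (Suc N)"
  shows "deg_less (dird w p) N"
  unfolding deg_less_def
proof
  fix a
  assume "a \<in> Poly_Mapping.keys (dird w p)"
  then have "(\<Sum>i\<in>UNIV. w i * Poly_Mapping.lookup (pd i p) a) \<noteq> 0"
    by (simp add: in_keys_iff dird_def lookup_sum lookup_Cst_mult)
  then obtain i where "w i * Poly_Mapping.lookup (pd i p) a \<noteq> 0"
    by (meson sum.neutral)
  then have "a + Poly_Mapping.single i 1 \<in> Poly_Mapping.keys p"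
    by (auto simp: lookup_pd in_keys_iff)
  then show "(\<Sum>i\<in>UNIV. Poly_Mapping.lookup a i) < N"
    using assms by (force simp: deg_less_def sum_lookup_add_single simp del: One_nat_def)
qed

lemma deg_less_dird_pow: "deg_less p (k + N) \<Longrightarrow> deg_less ((dird w ^^ k) p) N"
proof (induction k arbitrary: N)
  case (Suc k)
  then have "deg_less ((dird w ^^ k) p) (Suc N)" by simp
  then show ?case by (simp add: deg_less_dird)
qed simp

lemma dird_nilpotent: "\<exists>N. (dird w ^^ N) p = 0"
  using ex_deg_less[of p] deg_less_dird_pow[of p _ 0] by (auto simp: deg_less_0)

lemma dird_add_dir: "dird (\<lambda>i. v i + t * w i) p = dird v p + Cst t * dird w p"
proof -
  have "Cst (t * w i) * pd i p = Cst t * (Cst (w i) * pd i p)" for i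
    by (simp add: mult_single flip: mult.assoc)
  then show ?thesis
    by (simp add: dird_def single_add distrib_right sum.distrib sum_distrib_left mult.assoc)
qed

text \<open>The derivatives commute, so the N-th power of D_v + t D_w expands binomially in t.
  Coefficient 0 is carried along because the recursion for coefficient 1 uses it.\<close>

lemma dird_pencil:
  fixes p :: "('n::finite, 'k::comm_ring_1) mpol"
  shows "\<exists>Q. (\<forall>t. (dird (\<lambda>i. v i + t * w i) ^^ N) p = poly Q (Cst t)) \<and>
    coeff Q 0 = (dird v ^^ N) p \<and> coeff Q 1 = of_nat N * (dird v ^^ (N - 1)) (dird w p)"
proof (induction N)
  case 0
  show ?case by (rule exI[of _ "[:p:]"]) simp
next
  case (Suc N)
  then obtain Q where Q: "\<And>t. (dird (\<lambda>i. v i + t * w i) ^^ N) p = poly Q (Cst t)"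
    and Q0: "coeff Q 0 = (dird v ^^ N) p"
    and Q1: "coeff Q 1 = of_nat N * (dird v ^^ (N - 1)) (dird w p)"
    by blast
  \<comment> \<open>Derivatives kill \<open>Cst t\<close>, hence act on \<open>P\<close>
    coefficientwise.\<close>
  have ev: "dird u (poly P (Cst t)) = poly (map_poly (dird u) P) (Cst t)" for u t P
    by (induction P) (simp_all add: map_poly_pCons dird_add dird_Cst_mult)
  let ?Q = "map_poly (dird v) Q + pCons 0 (map_poly (dird w) Q)"
  have "(dird (\<lambda>i. v i + t * w i) ^^ Suc N) p = poly ?Q (Cst t)" for t
    by (simp add: Q dird_add_dir ev)
  moreover have "coeff ?Q 0 = (dird v ^^ Suc N) p"
    by (simp add: coeff_map_poly Q0)
  moreover have "coeff ?Q 1 = of_nat (Suc N) * (dird v ^^ (Suc N - 1)) (dird w p)"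
  proof (cases N)
    case 0
    then show ?thesis using Q1 by (simp add: coeff_map_poly Q0)
  next
    case (Suc M)
    have "dird v (of_nat N * r) = of_nat N * dird v r" for r
      using dird_Cst_mult[of v "of_nat N" r] by simp
    moreover have "(dird v ^^ N) (dird w p) = dird v ((dird v ^^ (N - 1)) (dird w p))"
      by (simp add: Suc)
    ultimately have "coeff (map_poly (dird v) Q) 1 = of_nat N * (dird v ^^ N) (dird w p)"
      using Q1 by (simp add: coeff_map_poly del: One_nat_def)
    then show ?thesis
      by (simp add: coeff_map_poly Q0 dird_pow_commute distrib_right add.commute)
  qed
  ultimately show ?case by blast
qed

text \<open>The e-th derivative along w is e! times the value at w of the homogeneous part of degree
  e. Instead of evaluating that part, the proof finds w by moving one coordinate at a time in a
  pencil, where a polynomial in one parameter has only finitely many roots.\<close>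

lemma ex_direction_degree:
  fixes p :: "('n::finite, 'k::field_char_0) mpol"
  assumes "deg_less p (Suc e)" "\<exists>a\<in>Poly_Mapping.keys p. (\<Sum>i\<in>UNIV. Poly_Mapping.lookup a i) = e"
  shows "\<exists>w c. c \<noteq> 0 \<and> (dird w ^^ e) p = Cst c"
  using assms
proof (induction e arbitrary: p)
  case 0
  then have p: "p = Cst (Poly_Mapping.lookup p 0)" by (simp add: deg_less_1_iff)
  moreover have "p \<noteq> 0" using 0 by auto
  ultimately have "Poly_Mapping.lookup p 0 \<noteq> 0" by (metis single_zero)
  then show ?case using p by auto
next
  case (Suc e)
  from Suc.prems(2) obtain a
    where a: "a \<in> Poly_Mapping.keys p" "(\<Sum>i\<in>UNIV. Poly_Mapping.lookup a i) = Suc e"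
    by blast
  then obtain i where i: "Poly_Mapping.lookup a i \<noteq> 0"
    by (metis Zero_not_Suc sum.neutral)
  define b where "b = a - Poly_Mapping.single i 1"
  have ab: "b + Poly_Mapping.single i 1 = a"
    unfolding b_def using i by (rule diff_single_add)
  define u :: "'n \<Rightarrow> 'k" where "u = (\<lambda>j. if j = i then 1 else 0)"
  have u: "dird u p = pd i p" unfolding u_def by (rule dird_axis)
  \<comment> \<open>Characteristic zero keeps the exponent that comes down as a factor
    nonzero.\<close>
  have "Poly_Mapping.lookup (pd i p) b \<noteq> 0"
    using a(1) of_nat_neq_0 by (simp only: lookup_pd ab in_keys_iff) (simp add: of_nat_neq_0 del: of_nat_Suc)
  moreover have "(\<Sum>i\<in>UNIV. Poly_Mapping.lookup b i) = e"
    using a(2) sum_lookup_add_single[of b i] unfolding ab by simp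
  moreover have "deg_less (pd i p) (Suc e)"
    using deg_less_dird[OF Suc.prems(1), of u] by (simp add: u)
  ultimately have "\<exists>w c. c \<noteq> 0 \<and> (dird w ^^ e) (pd i p) = Cst c"
    by (intro Suc.IH bexI[of _ b]) (simp_all add: in_keys_iff)
  then obtain w c where c: "c \<noteq> 0" "(dird w ^^ e) (dird u p) = Cst c"
    unfolding u by blast
  obtain Q where Q: "\<And>t. (dird (\<lambda>i. w i + t * u i) ^^ Suc e) p = poly Q (Cst t)"
    and Q1: "coeff Q 1 = of_nat (Suc e) * (dird w ^^ (Suc e - 1)) (dird u p)"
    using dird_pencil[of "Suc e" w u p] by blast
  \<comment> \<open>The derivative of order \<open>Suc e\<close> is constant by the degree bound, so
    its constant term decides whether it vanishes. As a function of the parameter that term is the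
    polynomial \<open>q\<close>, whose linear coefficient turns out nonzero.\<close>
  define q where "q = map_poly (\<lambda>r. Poly_Mapping.lookup r 0) Q"
  have q: "poly q t = Poly_Mapping.lookup (poly Q (Cst t)) 0" for t
    unfolding q_def
    by (induction Q) (simp_all add: map_poly_pCons lookup_add lookup_Cst_mult)
  have "coeff q 1 = of_nat (Suc e) * c"
    using Q1 c(2) lookup_Cst_mult[of "of_nat (Suc e)" "Cst c" 0]
    by (simp add: q_def coeff_map_poly del: of_nat_Suc)
  then have "coeff q 1 \<noteq> 0" using c(1) by (simp del: of_nat_Suc)
  then have "q \<noteq> 0" by auto
  then have "{t. poly q t = 0} \<noteq> UNIV"
    using poly_roots_finite[of q] infinite_UNIV_char_0 by metis
  then obtain t where t: "poly q t \<noteq> 0" by blast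
  let ?v = "\<lambda>i. w i + t * u i"
  have "deg_less ((dird ?v ^^ Suc e) p) (Suc 0)"
    using Suc.prems(1) deg_less_dird_pow[of p "Suc e" "Suc 0"] by simp
  then have "(dird ?v ^^ Suc e) p = Cst (Poly_Mapping.lookup ((dird ?v ^^ Suc e) p) 0)"
    by (rule deg_less_1_iff[THEN iffD1])
  moreover have "Poly_Mapping.lookup ((dird ?v ^^ Suc e) p) 0 \<noteq> 0"
    using t unfolding q Q .
  ultimately show ?case by blast
qed

lemma ex_direction:
  fixes p :: "('n::finite, 'k::field_char_0) mpol"
  assumes "p \<noteq> 0"
  shows "\<exists>w e c. c \<noteq> 0 \<and> (dird w ^^ e) p = Cst c"
proof -
  let ?d = "\<lambda>a. \<Sum>i\<in>UNIV. Poly_Mapping.lookup a i"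
  let ?e = "Max (?d ` Poly_Mapping.keys p)"
  have fin: "finite (?d ` Poly_Mapping.keys p)" by simp
  have ne: "?d ` Poly_Mapping.keys p \<noteq> {}" using assms by simp
  have "deg_less p (Suc ?e)"
    using Max_ge[OF fin] by (auto simp: deg_less_def less_Suc_eq_le)
  moreover have "\<exists>a\<in>Poly_Mapping.keys p. ?d a = ?e"
    using Max_in[OF fin ne] by force
  ultimately show ?thesis using ex_direction_degree by blast
qed

section \<open>Iterated derivatives of products and powers\<close>

lemma dird_pow_add: "(dird w ^^ k) (p + q) = (dird w ^^ k) p + (dird w ^^ k) q"
  by (induction k) (simp_all add: dird_add)

lemma dird_pow_diff: "(dird w ^^ k) (p - q) = (dird w ^^ k) p - (dird w ^^ k) q"
  by (induction k) (simp_all add: dird_diff)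

lemma dird_pow_const_mult: "dird w h = 0 \<Longrightarrow> (dird w ^^ k) (h * p) = h * (dird w ^^ k) p"
  by (induction k) (simp_all add: dird_mult)

text \<open>In the Leibniz expansion only the term with \<open>a\<close> derivatives on
  \<open>f\<close> and \<open>b\<close> on \<open>g\<close> survives. The induction peels off one
  derivative and combines the two binomial coefficients by Pascal's rule.\<close>

lemma dird_pow_mult_Cst:
  fixes f g :: "('n::finite, 'k::comm_ring_1) mpol"
  assumes "(dird w ^^ a) f = Cst \<alpha>" "(dird w ^^ b) g = Cst \<beta>"
  shows "(dird w ^^ (a + b)) (f * g) = Cst (of_nat (a + b choose a) * \<alpha> * \<beta>)"
  using assms
proof (induction "a + b" arbitrary: a b f g)
  case 0
  then show ?case by (simp add: mult_single)
next
  case (Suc n)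
  show ?case
  proof (cases a)
    case 0
    then show ?thesis
      using Suc.prems by (simp add: dird_pow_const_mult mult_single)
  next
    case a: (Suc a')
    show ?thesis
    proof (cases b)
      case 0
      then show ?thesis
        using Suc.prems dird_pow_const_mult[of w g a f] by (simp add: mult_single mult.commute)
    next
      case b: (Suc b')
      have f: "(dird w ^^ a') (dird w f) = Cst \<alpha>" and g: "(dird w ^^ b') (dird w g) = Cst \<beta>"
        using Suc.prems by (simp_all add: a b funpow_swap1)
      have 1: "(dird w ^^ n) (dird w f * g) = Cst (of_nat (n choose a') * \<alpha> * \<beta>)"
        using Suc.hyps(1)[OF _ f Suc.prems(2)] Suc.hyps(2) a by simp
      have 2: "(dird w ^^ n) (f * dird w g) = Cst (of_nat (n choose a) * \<alpha> * \<beta>)"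
        using Suc.hyps(1)[OF _ Suc.prems(1) g] Suc.hyps(2) b by simp
      have "(dird w ^^ (a + b)) (f * g) = (dird w ^^ n) (dird w (f * g))"
        using Suc.hyps(2) by (metis comp_apply funpow_Suc_right)
      also have "\<dots> = Cst (of_nat (Suc n choose a) * \<alpha> * \<beta>)"
        using 1 2 by (simp add: dird_mult dird_pow_add a algebra_simps flip: single_add)
      finally show ?thesis using Suc.hyps(2) by simp
    qed
  qed
qed

text \<open>Each further factor \<open>f\<close> contributes \<open>c\<close> times a binomial
  coefficient, which is nonzero in characteristic zero.\<close>

lemma dird_pow_power_Cst:
  fixes f :: "('n::finite, 'k::field_char_0) mpol"
  assumes "(dird w ^^ e) f = Cst c" "c \<noteq> 0"
  shows "\<exists>c'. c' \<noteq> 0 \<and> (dird w ^^ (t * e)) (f ^ t) = Cst c'"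
proof (induction t)
  case 0
  show ?case by (rule exI[of _ 1]) simp
next
  case (Suc t)
  then obtain c' where "c' \<noteq> 0" "(dird w ^^ (t * e)) (f ^ t) = Cst c'" by blast
  then show ?case
    using dird_pow_mult_Cst[OF assms(1), of "t * e" "f ^ t" c'] assms(2)
    by (intro exI[of _ "of_nat (e + t * e choose e) * c * c'"]) (auto simp: binomial_eq_0_iff)
qed

section \<open>Ideals and spans modulo an ideal\<close>

definition is_ideal :: "'a::comm_ring_1 set \<Rightarrow> bool" where
  "is_ideal I \<longleftrightarrow> 0 \<in> I \<and> (\<forall>x\<in>I. \<forall>y\<in>I. x + y \<in> I) \<and> (\<forall>r. \<forall>x\<in>I. r * x \<in> I)"

lemma is_ideal_zero: "is_ideal I \<Longrightarrow> 0 \<in> I"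
  and is_ideal_add: "is_ideal I \<Longrightarrow> x \<in> I \<Longrightarrow> y \<in> I \<Longrightarrow> x + y \<in> I"
  and is_ideal_mult: "is_ideal I \<Longrightarrow> x \<in> I \<Longrightarrow> r * x \<in> I"
  by (auto simp: is_ideal_def)

text \<open>The coefficients form an arbitrary set \<open>C\<close>, because both a subring S and
  the contraction Q \<inter> S of a prime occur in this place.\<close>

inductive_set span_mod :: "'a::comm_ring_1 set \<Rightarrow> 'a set \<Rightarrow> 'a set \<Rightarrow> 'a set"
  for C U I :: "'a set" where
  ideal: "x \<in> I \<Longrightarrow> x \<in> span_mod C U I"
| mult: "c \<in> C \<Longrightarrow> u \<in> U \<Longrightarrow> c * u \<in> span_mod C U I"
| add: "x \<in> span_mod C U I \<Longrightarrow> y \<in> span_mod C U I \<Longrightarrow> x + y \<in> span_mod C U I"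

lemma span_mod_scale:
  assumes "x \<in> span_mod C U I" "is_ideal I" "\<And>c. c \<in> C \<Longrightarrow> r * c \<in> C'" "I \<subseteq> I'"
  shows "r * x \<in> span_mod C' U I'"
  using assms(1)
proof induction
  case (ideal x)
  then show ?case using assms(2,4) by (auto intro: span_mod.ideal is_ideal_mult)
next
  case (mult c u)
  then show ?case using span_mod.mult[of "r * c" C' u U I'] assms(3) by (simp add: mult.assoc)
next
  case (add x y)
  then show ?case by (simp add: distrib_left span_mod.add)
qed

text \<open>As for finite modules in a tower, the products of the two generating sets
  generate.\<close>

lemma span_mod_trans:
  assumes "x \<in> span_mod C U I" "C \<subseteq> span_mod C' U' I" "is_ideal I"
  shows "x \<in> span_mod C' ((\<lambda>(u, v). u * v) ` (U' \<times> U)) I"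
  using assms(1)
proof induction
  case (ideal x)
  then show ?case by (rule span_mod.ideal)
next
  case (mult c u)
  have "y * u \<in> span_mod C' ((\<lambda>(u, v). u * v) ` (U' \<times> U)) I"
    if "y \<in> span_mod C' U' I" for y
    using that
  proof induction
    case (ideal x)
    then show ?case
      using is_ideal_mult[OF assms(3), of x u] by (auto intro: span_mod.ideal simp: mult.commute)
  next
    case (mult c u')
    then show ?case using \<open>u \<in> U\<close>
      by (auto simp: mult.assoc intro!: span_mod.mult)
  next
    case (add x y)
    then show ?case by (simp add: distrib_right span_mod.add)
  qed
  then show ?case using mult assms(2) by blast
next
  case (add x y)
  then show ?case by (auto intro: span_mod.add)
qed

section \<open>Monic directions for an ideal\<close>

definition dconst :: "('n::finite \<Rightarrow> 'k) list \<Rightarrow> ('n, 'k::comm_ring_1) mpol set" where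
  "dconst ws = {p. \<forall>w\<in>set ws. dird w p = 0}"

text \<open>The newest direction stands at the head. Having a nonzero constant as iterated
  derivative replaces being monic in a coordinate, so coordinates are never changed. The case
  \<open>e = 0\<close> means that \<open>I\<close> contains a nonzero constant.\<close>

fun monic_dirs :: "('n::finite, 'k::comm_ring_1) mpol set \<Rightarrow> ('n \<Rightarrow> 'k) list \<Rightarrow> bool" where
  "monic_dirs I [] \<longleftrightarrow> True"
| "monic_dirs I (w # ws) \<longleftrightarrow> monic_dirs I ws \<and>
     (\<exists>f\<in>I \<inter> dconst ws. \<exists>e c. c \<noteq> 0 \<and> (dird w ^^ e) f = Cst c)"

lemma dconst_add: "p \<in> dconst ws \<Longrightarrow> q \<in> dconst ws \<Longrightarrow> p + q \<in> dconst ws"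
  and dconst_diff: "p \<in> dconst ws \<Longrightarrow> q \<in> dconst ws \<Longrightarrow> p - q \<in> dconst ws"
  and dconst_mult: "p \<in> dconst ws \<Longrightarrow> q \<in> dconst ws \<Longrightarrow> p * q \<in> dconst ws"
  and dconst_Cst: "Cst c \<in> dconst ws"
  and dconst_dird: "p \<in> dconst ws \<Longrightarrow> dird w p \<in> dconst ws"
  by (auto simp: dconst_def dird_add dird_diff dird_mult dird_commute[of _ w])

lemma dconst_dird_pow: "p \<in> dconst ws \<Longrightarrow> (dird w ^^ k) p \<in> dconst ws"
  by (induction k) (simp_all add: dconst_dird)

lemma dconst_power: "p \<in> dconst ws \<Longrightarrow> p ^ k \<in> dconst ws"
  using dconst_Cst[of 1 ws] by (induction k) (simp_all add: dconst_mult)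

text \<open>A list can be extended by \<open>ex_direction\<close> as long as \<open>I\<close>
  contains a nonzero polynomial constant along it.\<close>

lemma ex_monic_dirs:
  fixes I :: "('n::finite, 'k::field_char_0) mpol set"
  shows "(\<exists>ws. length ws = c \<and> monic_dirs I ws) \<or>
    (\<exists>ws. length ws < c \<and> monic_dirs I ws \<and> I \<inter> dconst ws \<subseteq> {0})"
proof (induction c)
  case 0
  show ?case by (intro disjI1 exI[of _ "[]"]) simp
next
  case (Suc c)
  then consider ws where "length ws = c" "monic_dirs I ws"
    | ws where "length ws < c" "monic_dirs I ws" "I \<inter> dconst ws \<subseteq> {0}" by blast
  then show ?case
  proof cases
    case (1 ws)
    show ?thesis
    proof (cases "I \<inter> dconst ws \<subseteq> {0}")
      case True
      then show ?thesis using 1 by (intro disjI2 exI[of _ ws]) simp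
    next
      case False
      then obtain f where "f \<in> I \<inter> dconst ws" "f \<noteq> 0" by blast
      then obtain w where "monic_dirs I (w # ws)"
        using ex_direction[of f] 1 by auto
      then show ?thesis using 1(1) by (intro disjI1 exI[of _ "w # ws"]) simp
    qed
  next
    case (2 ws)
    then show ?thesis by (intro disjI2 exI[of _ ws]) simp
  qed
qed

text \<open>Division with remainder by f in the direction w, where the derivatives of f play the
  role of the powers of a coordinate.\<close>

lemma dconst_subset_span_mod:
  fixes I :: "('n::finite, 'k::field_char_0) mpol set"
  assumes I: "is_ideal I" and f: "f \<in> I" "f \<in> dconst ws"
    and c: "c \<noteq> 0" "(dird w ^^ e) f = Cst c"
  shows "dconst ws \<subseteq> span_mod (dconst (w # ws)) ((\<lambda>k. (dird w ^^ k) f) ` {..e}) I"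
    (is "_ \<subseteq> ?M")
proof
  fix g
  assume g: "g \<in> dconst ws"
  obtain N where "(dird w ^^ N) g = 0" using dird_nilpotent by blast
  then show "g \<in> ?M" using g
  proof (induction N arbitrary: g)
    case 0
    then show ?case using is_ideal_zero[OF I] by (auto intro: span_mod.ideal)
  next
    case (Suc N)
    show ?case
    proof (cases "e = 0")
      case True
      \<comment> \<open>Here \<open>f\<close> is a nonzero constant, so \<open>I\<close> is the
        whole ring.\<close>
      then have "g = g * Cst (1 / c) * f"
        using c by (simp add: mult.assoc mult_single)
      then have "g \<in> I" using is_ideal_mult[OF I f(1)] by metis
      then show ?thesis by (rule span_mod.ideal)
    next
      case False
      \<comment> \<open>\<open>P\<close> plays the role of the N-th power of a coordinate: with N =
        q e + r, the N-th derivative of \<open>P\<close> along \<open>w\<close> is a nonzero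
        constant \<open>d\<close>.\<close>
      define r q where "r = N mod e" and "q = N div e"
      define P where "P = (dird w ^^ (e - r)) f * f ^ q"
      have r: "r < e" using False by (simp add: r_def)
      have "(dird w ^^ r) ((dird w ^^ (e - r)) f) = Cst c"
        using c(2) r by (metis comp_apply funpow_add le_add_diff_inverse less_imp_le)
      moreover obtain c' where "c' \<noteq> 0" "(dird w ^^ (q * e)) (f ^ q) = Cst c'"
        using dird_pow_power_Cst[OF c(2,1)] by blast
      ultimately have "(dird w ^^ (r + q * e)) P = Cst (of_nat (r + q * e choose r) * c * c')"
        "of_nat (r + q * e choose r) * c * c' \<noteq> 0"
        using dird_pow_mult_Cst c(1) by (auto simp: P_def binomial_eq_0_iff)
      then obtain d where d: "d \<noteq> 0" "(dird w ^^ N) P = Cst d"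
        by (metis add.commute mod_div_mult_eq mult.commute q_def r_def)
      \<comment> \<open>\<open>h\<close> is the leading coefficient of \<open>g\<close> relative to
        \<open>P\<close>. It is constant along \<open>w\<close> since the derivative of
        \<open>g\<close> of order \<open>Suc N\<close> vanishes, and subtracting
        \<open>h * P\<close> lowers the order to \<open>N\<close>.\<close>
      define h where "h = Cst (1 / d) * (dird w ^^ N) g"
      have hw: "dird w h = 0" using Suc.prems(1) by (simp add: h_def dird_Cst_mult)
      have h: "h \<in> dconst ws"
        unfolding h_def by (intro dconst_mult dconst_Cst dconst_dird_pow Suc.prems)
      have h': "h \<in> dconst (w # ws)" using h hw by (simp add: dconst_def)
      have P: "P \<in> dconst ws"
        unfolding P_def by (intro dconst_mult dconst_power dconst_dird_pow f)
      have "(dird w ^^ N) (h * P) = (dird w ^^ N) g"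
      proof -
        have "(dird w ^^ N) (h * P) = h * Cst d"
          using d(2) hw by (simp add: dird_pow_const_mult)
        also have "\<dots> = (Cst d * Cst (1 / d)) * (dird w ^^ N) g"
          by (simp only: h_def ac_simps)
        also have "\<dots> = (dird w ^^ N) g"
          using d(1) by (simp add: mult_single)
        finally show ?thesis .
      qed
      then have 1: "g - h * P \<in> ?M"
        using Suc.prems(2) h P by (intro Suc.IH dconst_diff dconst_mult) (simp_all add: dird_pow_diff)
      \<comment> \<open>For \<open>q = 0\<close>, \<open>P\<close> is one of the generators;
        otherwise \<open>f\<close> divides \<open>P\<close> and the product lies in
        \<open>I\<close>.\<close>
      have 2: "h * P \<in> ?M"
      proof (cases q)
        case 0
        then show ?thesis using h' by (auto simp: P_def intro!: span_mod.mult)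
      next
        case (Suc q')
        have "h * P = (h * (dird w ^^ (e - r)) f * f ^ q') * f"
          by (simp add: P_def Suc ac_simps)
        then have "h * P \<in> I" using is_ideal_mult[OF I f(1)] by metis
        then show ?thesis by (rule span_mod.ideal)
      qed
      show ?thesis using span_mod.add[OF 1 2] by simp
    qed
  qed
qed

text \<open>The finiteness half of Noether normalization, one direction at a time by
  \<open>span_mod_trans\<close>.\<close>

lemma monic_dirs_finite_span:
  fixes I :: "('n::finite, 'k::field_char_0) mpol set"
  assumes "is_ideal I" "monic_dirs I ws"
  shows "\<exists>U. finite U \<and> span_mod (dconst ws) U I = UNIV"
  using assms(2)
proof (induction ws)
  case Nil
  have "p \<in> span_mod (dconst []) {1} I" for p
    using span_mod.mult[of p "dconst []" 1 "{1}" I] by (simp add: dconst_def)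
  then show ?case by (intro exI[of _ "{1}"]) auto
next
  case (Cons w ws)
  then obtain U where U: "finite U" "span_mod (dconst ws) U I = UNIV" by auto
  from Cons.prems obtain f e c where "f \<in> I" "f \<in> dconst ws" "c \<noteq> 0" "(dird w ^^ e) f = Cst c"
    by auto
  then have sub: "dconst ws \<subseteq> span_mod (dconst (w # ws)) ((\<lambda>k. (dird w ^^ k) f) ` {..e}) I"
    by (rule dconst_subset_span_mod[OF assms(1)])
  show ?case
    using span_mod_trans[OF _ sub assms(1), of _ U] U
    by (intro exI[of _ "(\<lambda>(u, v). u * v) ` ((\<lambda>k. (dird w ^^ k) f) ` {..e} \<times> U)"]) auto
qed

section \<open>Lying over\<close>

lemma prime_ideal_is_ideal: "prime_ideal P \<Longrightarrow> is_ideal P"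
  by (simp add: prime_ideal_def is_ideal_def)

lemma prime_ideal_one: "prime_ideal P \<Longrightarrow> 1 \<notin> P"
  unfolding prime_ideal_def by (metis UNIV_eq_I mult.right_neutral)

lemma prime_idealD: "prime_ideal P \<Longrightarrow> x * y \<in> P \<Longrightarrow> x \<in> P \<or> y \<in> P"
  by (simp add: prime_ideal_def)

text \<open>Zorn's lemma gives an ideal maximal among those containing \<open>E\<close> and avoiding
  \<open>T\<close>; such an ideal is prime.\<close>

lemma ex_prime_ideal_disjoint:
  fixes E T :: "'a::comm_ring_1 set"
  assumes E: "is_ideal E" and one: "1 \<in> T"
    and mult: "\<And>x y. x \<in> T \<Longrightarrow> y \<in> T \<Longrightarrow> x * y \<in> T" and disj: "E \<inter> T = {}"
  shows "\<exists>P. prime_ideal P \<and> E \<subseteq> P \<and> P \<inter> T = {}"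
proof -
  let ?A = "{J. is_ideal J \<and> E \<subseteq> J \<and> J \<inter> T = {}}"
  have "\<exists>M\<in>?A. \<forall>X\<in>?A. M \<subseteq> X \<longrightarrow> X = M"
  proof (rule subset_Zorn_nonempty)
    show "?A \<noteq> {}" using E disj by blast
  next
    fix \<C>
    assume ne: "\<C> \<noteq> {}" and chain: "subset.chain ?A \<C>"
    then have sub: "\<C> \<subseteq> ?A" and lin: "\<And>A B. A \<in> \<C> \<Longrightarrow> B \<in> \<C> \<Longrightarrow> A \<subseteq> B \<or> B \<subseteq> A"
      by (auto simp: subset_chain_def)
    have "is_ideal (\<Union>\<C>)"
      unfolding is_ideal_def
    proof (intro conjI ballI allI)
      show "0 \<in> \<Union>\<C>" using ne sub is_ideal_zero by blast
    next
      fix x y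
      assume "x \<in> \<Union>\<C>" "y \<in> \<Union>\<C>"
      then obtain A B where "A \<in> \<C>" "x \<in> A" "B \<in> \<C>" "y \<in> B" by blast
      then obtain D where "D \<in> \<C>" "x \<in> D" "y \<in> D" using lin by blast
      then show "x + y \<in> \<Union>\<C>" using sub is_ideal_add by blast
    next
      fix r x
      assume "x \<in> \<Union>\<C>"
      then show "r * x \<in> \<Union>\<C>" using sub is_ideal_mult by blast
    qed
    then show "\<Union>\<C> \<in> ?A" using ne sub by blast
  qed
  then obtain P where "P \<in> ?A" and maxA: "\<And>X. X \<in> ?A \<Longrightarrow> P \<subseteq> X \<Longrightarrow> X = P"
    by (elim bexE) simp
  then have P: "is_ideal P" "E \<subseteq> P" "P \<inter> T = {}" by simp_all
  have max: "X = P" if "is_ideal X" "P \<subseteq> X" "X \<inter> T = {}" for X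
    using maxA[of X] that P(2) by auto
  \<comment> \<open>By maximality, the ideal generated by \<open>P\<close> and \<open>x\<close> must
    meet \<open>T\<close>. For two elements outside \<open>P\<close> with product in
    \<open>P\<close>, multiplying two such members of \<open>T\<close> would give an element of both
    \<open>P\<close> and \<open>T\<close>.\<close>
  have meet: "\<exists>p\<in>P. \<exists>r. p + r * x \<in> T" if "x \<notin> P" for x
  proof (rule ccontr)
    assume none: "\<not> ?thesis"
    let ?X = "{p + r * x |p r. p \<in> P}"
    have "is_ideal ?X"
      unfolding is_ideal_def
    proof (intro conjI ballI allI)
      have "0 = 0 + 0 * x" by simp
      then show "0 \<in> ?X" using is_ideal_zero[OF P(1)] by blast
    next
      fix y z
      assume "y \<in> ?X" "z \<in> ?X"
      then obtain p r p' r' where "p \<in> P" "p' \<in> P" "y = p + r * x" "z = p' + r' * x" by blast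
      then have "y + z = (p + p') + (r + r') * x" "p + p' \<in> P"
        using is_ideal_add[OF P(1)] by (simp_all add: algebra_simps)
      then show "y + z \<in> ?X" by blast
    next
      fix s y
      assume "y \<in> ?X"
      then obtain p r where "p \<in> P" "y = p + r * x" by blast
      then have "s * y = s * p + (s * r) * x" "s * p \<in> P"
        using is_ideal_mult[OF P(1)] by (simp_all add: algebra_simps)
      then show "s * y \<in> ?X" by blast
    qed
    moreover have "P \<subseteq> ?X"
    proof
      fix p assume "p \<in> P"
      moreover have "p = p + 0 * x" by simp
      ultimately show "p \<in> ?X" by blast
    qed
    moreover have "?X \<inter> T = {}" using none by blast
    ultimately have "?X = P" by (rule max)
    moreover have "x \<in> ?X"
    proof -
      have "x = 0 + 1 * x" by simp
      then show ?thesis using is_ideal_zero[OF P(1)] by blast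
    qed
    ultimately show False using that by blast
  qed
  have "prime_ideal P"
    unfolding prime_ideal_def
  proof (intro conjI allI impI)
    fix x y
    assume xy: "x * y \<in> P"
    show "x \<in> P \<or> y \<in> P"
    proof (rule ccontr)
      assume "\<not> ?thesis"
      then obtain p r p' r' where p: "p \<in> P" "p + r * x \<in> T" and p': "p' \<in> P" "p' + r' * y \<in> T"
        using meet[of x] meet[of y] by blast
      have "(p + r * x) * (p' + r' * y) = (p' + r' * y) * p + (r * x) * p' + (r * r') * (x * y)"
        by (simp add: algebra_simps)
      also have "\<dots> \<in> P"
        by (rule is_ideal_add[OF P(1) is_ideal_add[OF P(1)]])
          (rule is_ideal_mult[OF P(1)], rule p p' xy)+
      finally show False using mult[OF p(2) p'(2)] P(3) by blast
    qed
  qed (use P one in \<open>auto simp: is_ideal_def\<close>)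
  then show ?thesis using P by blast
qed

text \<open>Collects the coefficients of one generator, the elementary step of the elimination
  below.\<close>

lemma span_mod_insert:
  assumes "x \<in> span_mod C (insert u U) I" "is_ideal I" "0 \<in> C"
    "\<And>a b. a \<in> C \<Longrightarrow> b \<in> C \<Longrightarrow> a + b \<in> C"
  shows "\<exists>a\<in>C. x - a * u \<in> span_mod C U I"
  using assms(1)
proof induction
  case (ideal x)
  then show ?case using assms(3) by (intro bexI[of _ 0]) (auto intro: span_mod.ideal)
next
  case (mult c v)
  show ?case
  proof (cases "v = u")
    case True
    then show ?thesis using mult is_ideal_zero[OF assms(2)]
      by (intro bexI[of _ c]) (auto intro: span_mod.ideal)
  next
    case False
    then show ?thesis using mult assms(3) by (intro bexI[of _ 0]) (auto intro: span_mod.mult)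
  qed
next
  case (add x y)
  then obtain a b where "a \<in> C" "b \<in> C" "x - a * u \<in> span_mod C U I" "y - b * u \<in> span_mod C U I"
    by blast
  then show ?case
    using span_mod.add[of "x - a * u" C U I "y - b * u"] assms(4)
    by (intro bexI[of _ "a + b"]) (simp_all add: algebra_simps)
qed

lemma span_mod_annihilate:
  assumes "x \<in> span_mod C U I" "is_ideal I" "\<And>u. u \<in> U \<Longrightarrow> b * u \<in> I"
  shows "b * x \<in> I"
  using assms(1)
proof induction
  case (ideal x)
  then show ?case by (rule is_ideal_mult[OF assms(2)])
next
  case (mult c u)
  then show ?case
    using is_ideal_mult[OF assms(2) assms(3), of u c] by (simp add: ac_simps)
next
  case (add x y)
  then show ?case by (simp add: distrib_left is_ideal_add[OF assms(2)])
qed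

definition is_subring :: "'a::comm_ring_1 set \<Rightarrow> bool" where
  "is_subring S \<longleftrightarrow> 1 \<in> S \<and> (\<forall>x\<in>S. \<forall>y\<in>S. x + y \<in> S \<and> x - y \<in> S \<and> x * y \<in> S)"

lemma is_subring_one: "is_subring S \<Longrightarrow> 1 \<in> S"
  and is_subring_add: "is_subring S \<Longrightarrow> x \<in> S \<Longrightarrow> y \<in> S \<Longrightarrow> x + y \<in> S"
  and is_subring_diff: "is_subring S \<Longrightarrow> x \<in> S \<Longrightarrow> y \<in> S \<Longrightarrow> x - y \<in> S"
  and is_subring_mult: "is_subring S \<Longrightarrow> x \<in> S \<Longrightarrow> y \<in> S \<Longrightarrow> x * y \<in> S"
  by (auto simp: is_subring_def)

text \<open>The determinant trick of Cayley and Hamilton, performed by eliminating one generator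
  after the other; the product of the pivots is b.\<close>

lemma determinant_trick:
  fixes S Q P :: "'a::comm_ring_1 set"
  assumes "finite U" and S: "is_subring S" and Q: "prime_ideal Q" and P: "is_ideal P"
    and "s \<in> S" "s \<notin> Q" "\<And>v. v \<in> U \<Longrightarrow> s * v \<in> span_mod (Q \<inter> S) U P"
  shows "\<exists>b. b \<in> S \<and> b \<notin> Q \<and> (\<forall>v\<in>U. b * v \<in> P)"
  using assms(1,5-)
proof (induction U arbitrary: s rule: finite_induct)
  case empty
  then show ?case by blast
next
  case (insert u U)
  note Qi = prime_ideal_is_ideal[OF Q]
  have S0: "0 \<in> S" using is_subring_diff[OF S, of 1 1] is_subring_one[OF S] by simp
  have split: "\<exists>a\<in>Q \<inter> S. x - a * u \<in> span_mod (Q \<inter> S) U P"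
    if "x \<in> span_mod (Q \<inter> S) (insert u U) P" for x
    using that P is_ideal_zero[OF Qi] S0
    by (rule span_mod_insert[OF _ _ IntI]) (auto intro: is_ideal_add[OF Qi] is_subring_add[OF S])
  have scale: "r * x \<in> span_mod (Q \<inter> S) U P" if "x \<in> span_mod (Q \<inter> S) U P" "r \<in> S" for r x
    using that(1) P by (rule span_mod_scale)
      (use that(2) in \<open>auto intro: is_ideal_mult[OF Qi] is_subring_mult[OF S]\<close>)
  obtain a where a: "a \<in> Q" "a \<in> S" "s * u - a * u \<in> span_mod (Q \<inter> S) U P"
    using split insert.prems(3) by blast
  \<comment> \<open>The pivot: the \<open>u\<close>-term of the relation for \<open>u\<close> is
    moved to the left. Subtracting an element of \<open>Q\<close> keeps it outside
    \<open>Q\<close>.\<close>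
  define s1 where "s1 = s - a"
  have s1: "s1 \<in> S" "s1 * u \<in> span_mod (Q \<inter> S) U P"
    using a insert.prems(1) by (simp_all add: s1_def is_subring_diff[OF S] left_diff_distrib)
  have s1Q: "s1 \<notin> Q"
  proof
    assume "s1 \<in> Q"
    then have "s1 + a \<in> Q" using a(1) by (rule is_ideal_add[OF Qi])
    then show False using insert.prems(2) by (simp add: s1_def)
  qed
  have "\<exists>b. b \<in> S \<and> b \<notin> Q \<and> (\<forall>v\<in>U. b * v \<in> P)"
  proof (rule insert.IH)
    show "s1 * s \<in> S" using s1 insert.prems(1) by (intro is_subring_mult[OF S])
    show "s1 * s \<notin> Q" using s1Q insert.prems(2) prime_idealD[OF Q] by blast
    fix v assume "v \<in> U"
    then obtain a' where a': "a' \<in> Q" "a' \<in> S" "s * v - a' * u \<in> span_mod (Q \<inter> S) U P"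
      using split insert.prems(3) by blast
    \<comment> \<open>Multiplying the relation for \<open>v\<close> by the pivot allows
      \<open>s1 * u\<close> to be replaced by a combination of the remaining generators.\<close>
    have "s1 * s * v = s1 * (s * v - a' * u) + a' * (s1 * u)"
      by (simp add: algebra_simps)
    also have "\<dots> \<in> span_mod (Q \<inter> S) U P"
      by (intro span_mod.add scale a' s1)
    finally show "s1 * s * v \<in> span_mod (Q \<inter> S) U P" .
  qed
  then obtain b where b: "b \<in> S" "b \<notin> Q" "\<And>v. v \<in> U \<Longrightarrow> b * v \<in> P" by blast
  \<comment> \<open>For the eliminated generator, \<open>s1 * u\<close> is a combination of
    \<open>U\<close> modulo \<open>P\<close>, and \<open>b\<close> kills it.\<close>
  have "s1 * b * v \<in> P" if "v \<in> insert u U" for v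
  proof (cases "v = u")
    case True
    then show ?thesis
      using span_mod_annihilate[OF s1(2) P b(3)] by (simp add: ac_simps)
  next
    case False
    then show ?thesis
      using that is_ideal_mult[OF P b(3), of v s1] by (simp add: mult.assoc)
  qed
  moreover have "s1 * b \<in> S" "s1 * b \<notin> Q"
    using s1 b s1Q prime_idealD[OF Q] by (auto intro: is_subring_mult[OF S])
  ultimately show ?case by blast
qed

text \<open>Taking \<open>P\<close> = \<open>I\<close> gives lying over, a larger \<open>P\<close>
  gives going up. The ideal E generated by \<open>P\<close> and Q \<inter> S avoids S - Q, and any
  prime containing E and avoiding S - Q contracts to Q \<inter> S. The prime of \<open>S\<close> is
  given as the contraction of a prime \<open>Q\<close> of the whole ring.\<close>

lemma lying_over:
  fixes S Q P I :: "'a::comm_ring_1 set"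
  assumes S: "is_subring S" and U: "finite U" "span_mod S U I = UNIV" and I: "is_ideal I"
    and P: "is_ideal P" "I \<subseteq> P" "P \<inter> S \<subseteq> Q" and Q: "prime_ideal Q"
  shows "\<exists>P'. prime_ideal P' \<and> P \<subseteq> P' \<and> P' \<inter> S = Q \<inter> S"
proof -
  note Qi = prime_ideal_is_ideal[OF Q]
  define E where "E = span_mod (Q \<inter> S) U P"
  \<comment> \<open>Expanding \<open>x\<close> over \<open>U\<close> moves \<open>q\<close> into the
    coefficients. This is why the span \<open>E\<close> is closed under multiplication by the whole
    ring.\<close>
  have qE: "q * x \<in> E" if "q \<in> Q" "q \<in> S" for q x
  proof -
    have "x \<in> span_mod S U I" using U(2) by simp
    then show ?thesis unfolding E_def
      using I by (rule span_mod_scale)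
        (use that P(2) in \<open>auto intro: is_subring_mult[OF S] simp: mult.commute[of q] is_ideal_mult[OF Qi]\<close>)
  qed
  have PE: "P \<subseteq> E" by (auto simp: E_def intro: span_mod.ideal)
  have QE: "Q \<inter> S \<subseteq> E"
    using qE[of _ 1] by auto
  have E: "is_ideal E"
    unfolding is_ideal_def
  proof (intro conjI ballI allI)
    show "0 \<in> E" using PE is_ideal_zero[OF P(1)] by blast
    show "x + y \<in> E" if "x \<in> E" "y \<in> E" for x y
      using that by (simp add: E_def span_mod.add)
    show "r * x \<in> E" if "x \<in> E" for r x
      using that unfolding E_def
    proof induction
      case (ideal x)
      then show ?case by (intro span_mod.ideal is_ideal_mult[OF P(1)])
    next
      case (mult c u)
      then show ?case using qE[of c "r * u"] by (simp add: E_def ac_simps)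
    next
      case (add x y)
      then show ?case by (simp add: distrib_left span_mod.add)
    qed
  qed
  \<comment> \<open>An element of E in S - Q maps all generators into E; the determinant trick then
    yields \<open>b\<close> in S - Q with \<open>b * 1\<close> in \<open>P\<close>, against P
    \<inter> S \<subseteq> Q.\<close>
  have ES: "E \<inter> (S - Q) = {}"
  proof (rule ccontr)
    assume "E \<inter> (S - Q) \<noteq> {}"
    then obtain s where s: "s \<in> E" "s \<in> S" "s \<notin> Q" by blast
    have "s * v \<in> span_mod (Q \<inter> S) U P" for v
      using is_ideal_mult[OF E s(1), of v] by (simp add: E_def mult.commute)
    then obtain b where b: "b \<in> S" "b \<notin> Q" "\<And>v. v \<in> U \<Longrightarrow> b * v \<in> P"
      using determinant_trick[OF U(1) S Q P(1) s(2,3)] by blast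
    have "1 \<in> span_mod S U P"
      using span_mod_scale[OF _ I _ P(2), of 1 S U 1 S] U(2) by simp
    then have "b * 1 \<in> P" using P(1) b(3) by (rule span_mod_annihilate)
    then show False using b P(3) by auto
  qed
  obtain P' where P': "prime_ideal P'" "E \<subseteq> P'" "P' \<inter> (S - Q) = {}"
    using ex_prime_ideal_disjoint[OF E _ _ ES] is_subring_one[OF S] prime_ideal_one[OF Q]
      is_subring_mult[OF S] prime_idealD[OF Q] by (metis DiffE DiffI)
  then show ?thesis using PE QE by blast
qed

section \<open>A chain of primes\<close>

text \<open>Fewer equations than unknowns, the unknowns being indexed by \<open>J\<close>. Two
  independent solutions of the shorter system combine to satisfy the new equation.\<close>

lemma homogeneous_system_nontrivial:
  fixes ws :: "('n::finite \<Rightarrow> 'k::field) list"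
  assumes "length ws < card J"
  shows "\<exists>v. (\<forall>i. i \<notin> J \<longrightarrow> v i = 0) \<and> (\<exists>i. v i \<noteq> 0) \<and> (\<forall>w\<in>set ws. (\<Sum>i\<in>UNIV. w i * v i) = 0)"
  using assms
proof (induction ws arbitrary: J)
  case Nil
  then obtain j where "j \<in> J" by fastforce
  then show ?case by (intro exI[of _ "\<lambda>i. if i = j then 1 else 0"]) auto
next
  case (Cons w ws)
  let ?L = "\<lambda>v. \<Sum>i\<in>UNIV. w i * v i"
  have J: "length ws < card (J - {j})" for j
    using Cons.prems by (auto simp: card_Diff_singleton_if)
  obtain v k where v: "\<And>i. i \<notin> J \<Longrightarrow> v i = 0" "v k \<noteq> 0" "\<forall>w\<in>set ws. (\<Sum>i\<in>UNIV. w i * v i) = 0"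
    using Cons.IH[OF J] by (metis Diff_iff)
  \<comment> \<open>Dropping the unknown \<open>k\<close>, at which \<open>v\<close> is nonzero,
    makes the second solution independent of the first.\<close>
  obtain v' where v': "\<And>i. i \<notin> J - {k} \<Longrightarrow> v' i = 0" "\<exists>i. v' i \<noteq> 0"
    "\<forall>w\<in>set ws. (\<Sum>i\<in>UNIV. w i * v' i) = 0"
    using Cons.IH[OF J] by metis
  show ?case
  proof (cases "?L v' = 0")
    case True
    then show ?thesis using v' by (intro exI[of _ v']) auto
  next
    case False
    \<comment> \<open>This combination is annihilated by \<open>?L\<close>; it is nonzero at
      \<open>k\<close> because \<open>v'\<close> vanishes there.\<close>
    define z where "z i = ?L v' * v i - ?L v * v' i" for i
    have lin: "(\<Sum>i\<in>UNIV. u i * z i) = ?L v' * (\<Sum>i\<in>UNIV. u i * v i) - ?L v * (\<Sum>i\<in>UNIV. u i * v' i)" for u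
    proof -
      have "(\<Sum>i\<in>UNIV. u i * z i)
        = (\<Sum>i\<in>UNIV. ?L v' * (u i * v i) - ?L v * (u i * v' i))"
        by (intro sum.cong) (simp_all add: z_def algebra_simps)
      then show ?thesis by (simp only: sum_subtractf sum_distrib_left)
    qed
    have "z k \<noteq> 0" using False v(2) v'(1)[of k] by (simp add: z_def)
    moreover have "z i = 0" if "i \<notin> J" for i using that v(1) v'(1) by (simp add: z_def)
    moreover have "\<forall>u\<in>set (w # ws). (\<Sum>i\<in>UNIV. u i * z i) = 0"
      unfolding lin using v(3) v'(3) by simp
    ultimately show ?thesis by blast
  qed
qed

section \<open>Linear forms and homomorphisms that specialise them\<close>

definition lin_form :: "('n::finite \<Rightarrow> 'k) \<Rightarrow> ('n, 'k::comm_ring_1) mpol" where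
  "lin_form v = (\<Sum>i\<in>UNIV. Cst (v i) * Var i)"

lemma pd_lin_form: "pd i (lin_form v) = Cst (v i)"
proof -
  have "pd i (lin_form v) = (\<Sum>j\<in>UNIV. if i = j then Cst (v j) else 0)"
    unfolding lin_form_def pd_sum by (intro sum.cong) (auto simp: pd_mult pd_Var)
  then show ?thesis by simp
qed

lemma dird_lin_form: "dird w (lin_form v) = Cst (\<Sum>i\<in>UNIV. w i * v i)"
proof -
  have "Cst (sum f A) = (\<Sum>i\<in>A. Cst (f i) :: ('a, 'b) mpol)" for f :: "'a \<Rightarrow> 'b" and A
    by (induction A rule: infinite_finite_induct) (simp_all add: single_add)
  then show ?thesis by (simp add: dird_def pd_lin_form mult_single)
qed

definition alg_hom :: "(('n, 'k::comm_ring_1) mpol \<Rightarrow> ('n, 'k) mpol) \<Rightarrow> bool" where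
  "alg_hom \<sigma> \<longleftrightarrow> (\<forall>p q. \<sigma> (p + q) = \<sigma> p + \<sigma> q \<and> \<sigma> (p * q) = \<sigma> p * \<sigma> q) \<and> (\<forall>c. \<sigma> (Cst c) = Cst c)"

lemma alg_hom_subst: "alg_hom (subst b)"
  by (simp add: alg_hom_def subst_add subst_mult)

lemma alg_hom_comp: "alg_hom \<sigma> \<Longrightarrow> alg_hom \<tau> \<Longrightarrow> alg_hom (\<tau> \<circ> \<sigma>)"
  by (simp add: alg_hom_def)

lemma alg_hom_zero: "alg_hom \<sigma> \<Longrightarrow> \<sigma> 0 = 0"
  unfolding alg_hom_def by (metis single_zero)

lemma alg_hom_sum: "alg_hom \<sigma> \<Longrightarrow> \<sigma> (sum f A) = (\<Sum>x\<in>A. \<sigma> (f x))"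
  by (induction A rule: infinite_finite_induct) (simp_all add: alg_hom_zero, simp add: alg_hom_def)

text \<open>The target is an integral domain.\<close>

lemma prime_ideal_kernel:
  fixes \<sigma> :: "('n::linorder, 'k::field) mpol \<Rightarrow> ('n, 'k) mpol"
  assumes "alg_hom \<sigma>"
  shows "prime_ideal {p. \<sigma> p = 0}"
proof -
  have "\<sigma> 1 = 1" using assms unfolding alg_hom_def by (metis single_one)
  then have "1 \<notin> {p. \<sigma> p = 0}" by simp
  then have "{p. \<sigma> p = 0} \<noteq> UNIV" by blast
  then show ?thesis
    using assms alg_hom_zero[OF assms] by (simp add: prime_ideal_def alg_hom_def)
qed

text \<open>\<open>X_i\<close> is replaced by the value that solves \<open>lin_form v = 0\<close>
  for it. Thus \<open>lin_form v\<close> goes to 0, while forms without \<open>X_i\<close> are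
  fixed.\<close>

lemma subst_kill_lin_form:
  fixes v u :: "'n::{finite,linorder} \<Rightarrow> 'k::field"
  assumes "v i \<noteq> 0"
  defines "\<tau> \<equiv> subst (\<lambda>j. if j = i then Var i - Cst (1 / v i) * lin_form v else Var j)"
  shows "\<tau> (lin_form u) = lin_form u - Cst (u i / v i) * lin_form v"
proof -
  have h: "alg_hom \<tau>" unfolding \<tau>_def by (rule alg_hom_subst)
  have "\<tau> (lin_form u) = (\<Sum>j\<in>UNIV. Cst (u j) * \<tau> (Var j))"
    unfolding lin_form_def alg_hom_sum[OF h] using h by (simp add: alg_hom_def)
  also have "\<dots> = (\<Sum>j\<in>UNIV. Cst (u j) * Var j - (if j = i then Cst (u i / v i) * lin_form v else 0))"
    by (intro sum.cong) (auto simp: \<tau>_def right_diff_distrib mult_single simp flip: mult.assoc)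
  also have "\<dots> = lin_form u - Cst (u i / v i) * lin_form v"
    by (simp add: sum_subtractf lin_form_def)
  finally show ?thesis .
qed

lemma sorted_wrt_psubset_snoc:
  assumes "sorted_wrt (\<subset>) cs" "cs \<noteq> []" "last cs \<subset> P"
  shows "sorted_wrt (\<subset>) (cs @ [P])"
proof -
  have "x \<subset> P" if "x \<in> set cs" for x
  proof (cases "x = last cs")
    case False
    have "sorted_wrt (\<subset>) (butlast cs @ [last cs])" using assms(1,2) by simp
    moreover have "x \<in> set (butlast cs)"
      using that False by (metis append_butlast_last_id assms(2) set_append Un_iff empty_iff
          empty_set set_ConsD)
    ultimately have "x \<subset> last cs" by (simp add: sorted_wrt_append)
    then show ?thesis using assms(3) by blast
  qed (use assms(3) in simp)
  then show ?thesis using assms(1) by (simp add: sorted_wrt_append)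
qed

lemma is_subring_dconst: "is_subring (dconst ws)"
  using dconst_Cst[of 1 ws] by (simp add: is_subring_def dconst_add dconst_diff dconst_mult)

text \<open>The primes of the subring are the kernels of maps that successively specialise
  independent linear forms of the subring to zero; each is lifted by lying over.\<close>

lemma ex_prime_chain:
  fixes I :: "('n::{finite,linorder}, 'k::field_char_0) mpol set"
  assumes I: "is_ideal I" and ws: "monic_dirs I ws" "I \<inter> dconst ws \<subseteq> {0}"
    and t: "t + length ws \<le> card (UNIV :: 'n set)"
  shows "\<exists>cs. length cs = Suc t \<and> (\<forall>P\<in>set cs. prime_ideal P \<and> I \<subseteq> P) \<and> sorted_wrt (\<subset>) cs"
proof -
  let ?S = "dconst ws"
  obtain U where U: "finite U" "span_mod ?S U I = UNIV"
    using monic_dirs_finite_span[OF I ws(1)] by blast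
  note lift = lying_over[OF is_subring_dconst U I]
  \<comment> \<open>Invariant: \<open>T\<close> holds the variables already solved for, \<sigma>
    fixes linear forms free of them, and the top prime of the chain contracts to the kernel of
    \<sigma>.\<close>
  have "\<exists>\<sigma> T cs. alg_hom \<sigma> \<and> card T = t \<and> (\<forall>v. (\<forall>i\<in>T. v i = 0) \<longrightarrow> \<sigma> (lin_form v) = lin_form v) \<and>
      length cs = Suc t \<and> (\<forall>P\<in>set cs. prime_ideal P \<and> I \<subseteq> P) \<and> sorted_wrt (\<subset>) cs \<and>
      last cs \<inter> ?S = {p. \<sigma> p = 0} \<inter> ?S"
    using t
  proof (induction t)
    case 0
    have id: "alg_hom (\<lambda>p :: ('n, 'k) mpol. p)" by (simp add: alg_hom_def)
    \<comment> \<open>The chain starts over the zero ideal, which is possible because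
      \<open>I\<close> meets \<open>?S\<close> only in 0.\<close>
    obtain P where "prime_ideal P" "I \<subseteq> P" "P \<inter> ?S = {p. p = 0} \<inter> ?S"
      using lift[OF I subset_refl _ prime_ideal_kernel[OF id]] ws(2) by auto
    then show ?case
      using id by (intro exI[of _ "\<lambda>p. p"] exI[of _ "{}"] exI[of _ "[P]"]) auto
  next
    case (Suc t)
    then obtain \<sigma> T cs where \<sigma>: "alg_hom \<sigma>" and T: "card T = t"
      and fix_lin: "\<And>v. (\<forall>i\<in>T. v i = 0) \<Longrightarrow> \<sigma> (lin_form v) = lin_form v"
      and cs: "length cs = Suc t" "\<forall>P\<in>set cs. prime_ideal P \<and> I \<subseteq> P" "sorted_wrt (\<subset>) cs"
      and last: "last cs \<inter> ?S = {p. \<sigma> p = 0} \<inter> ?S"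
      by auto
    \<comment> \<open>More free variables than directions: some nonzero linear form avoids
      \<open>T\<close> and is constant along \<open>ws\<close>.\<close>
    have "length ws < card (UNIV - T)"
      using Suc.prems T by (simp add: card_Diff_subset)
    then obtain v i where v: "\<And>i. i \<in> T \<Longrightarrow> v i = 0" "v i \<noteq> 0"
      "\<And>w. w \<in> set ws \<Longrightarrow> (\<Sum>i\<in>UNIV. w i * v i) = 0"
      using homogeneous_system_nontrivial[of ws "UNIV - T"] by auto
    define \<tau> where "\<tau> = subst (\<lambda>j. if j = i then Var i - Cst (1 / v i) * lin_form v else Var j)"
    have \<tau>: "\<tau> (lin_form u) = lin_form u - Cst (u i / v i) * lin_form v" for u
      unfolding \<tau>_def by (rule subst_kill_lin_form) (rule v(2))
    have h: "alg_hom (\<tau> \<circ> \<sigma>)"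
      using \<sigma> unfolding \<tau>_def by (intro alg_hom_comp alg_hom_subst)
    have vS: "lin_form v \<in> ?S" using v(3) by (simp add: dconst_def dird_lin_form)
    have \<sigma>v: "\<sigma> (lin_form v) = lin_form v" using v(1) by (intro fix_lin) auto
    have v0: "lin_form v \<noteq> 0"
      using pd_lin_form[of i v] v(2) by (metis lookup_single_eq lookup_zero pd_zero)
    have "cs \<noteq> []" using cs(1) by auto
    then have lastP: "prime_ideal (last cs)" "I \<subseteq> last cs" using cs(2) by auto
    have "last cs \<inter> ?S \<subseteq> {p. (\<tau> \<circ> \<sigma>) p = 0}"
      using last alg_hom_zero[OF alg_hom_subst] by (auto simp: \<tau>_def)
    then obtain P where P: "prime_ideal P" "last cs \<subseteq> P" "P \<inter> ?S = {p. (\<tau> \<circ> \<sigma>) p = 0} \<inter> ?S"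
      using lift[OF prime_ideal_is_ideal[OF lastP(1)] lastP(2) _ prime_ideal_kernel[OF h]] by blast
    have "v i / v i = 1" using v(2) by simp
    then have "(\<tau> \<circ> \<sigma>) (lin_form v) = lin_form v - Cst 1 * lin_form v"
      by (simp only: o_apply \<sigma>v \<tau>)
    then have "lin_form v \<in> {p. (\<tau> \<circ> \<sigma>) p = 0}"
      by (simp only: single_one mult_1_left diff_self mem_Collect_eq)
    then have "lin_form v \<in> P" using P(3) vS by blast
    \<comment> \<open>Strictness: \<sigma> fixes this nonzero form, so it is new in
      \<open>P\<close>.\<close>
    moreover have "lin_form v \<notin> {p. \<sigma> p = 0}"
      using v0 by (simp add: \<sigma>v)
    then have "lin_form v \<notin> last cs" using last vS by blast
    ultimately have "last cs \<subset> P" using P(2) by blast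
    then have "sorted_wrt (\<subset>) (cs @ [P])"
      using cs(3) \<open>cs \<noteq> []\<close> by (intro sorted_wrt_psubset_snoc)
    moreover have "i \<notin> T" using v by blast
    then have "card (insert i T) = Suc t" using T by simp
    moreover have "(\<tau> \<circ> \<sigma>) (lin_form u) = lin_form u" if "\<forall>j\<in>insert i T. u j = 0" for u
      using that by (simp add: fix_lin \<tau>)
    moreover have "length (cs @ [P]) = Suc (Suc t)" "last (cs @ [P]) = P"
      "\<forall>P'\<in>set (cs @ [P]). prime_ideal P' \<and> I \<subseteq> P'"
      using cs(1,2) P(1,2) lastP(2) by auto
    ultimately show ?case
      using h P(3) by (intro exI[of _ "\<tau> \<circ> \<sigma>"] exI[of _ "insert i T"] exI[of _ "cs @ [P]"]) metis
  qed
  then show ?thesis by blast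
qed

section \<open>Derivations on a module over the Weyl algebra\<close>

locale weyl_operators = commuting_operators sc X
  for sc :: "'k::field_char_0 \<Rightarrow> 'm::ab_group_add \<Rightarrow> 'm" and X :: "'n::{finite,linorder} \<Rightarrow> 'm \<Rightarrow> 'm" +
  fixes D :: "'n \<Rightarrow> 'm \<Rightarrow> 'm"
  assumes D_add: "D i (x + y) = D i x + D i y"
    and D_sc: "D i (sc a x) = sc a (D i x)"
    and D_commute: "D i (D j x) = D j (D i x)"
    and D_X: "D i (X j x) = X j (D i x) + (if i = j then x else 0)"
begin

lemma sc_minus: "sc a (- x) = - sc a x"
  using sc_add_right[of a x "- x"] by (simp add: eq_neg_iff_add_eq_0 add.commute)

lemma sc_sum: "sc a (sum f A) = (\<Sum>i\<in>A. sc a (f i))"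
  by (induction A rule: infinite_finite_induct) (simp_all add: sc_add_right)

lemma D_zero [simp]: "D i 0 = 0"
  using D_add[of i 0 0] by simp

lemma D_minus: "D i (- x) = - D i x"
  using D_add[of i x "- x"] by (simp add: eq_neg_iff_add_eq_0 add.commute)

lemma D_diff: "D i (x - y) = D i x - D i y"
  using D_add[of i x "- y"] by (simp add: D_minus)

lemma D_sum: "D i (sum f A) = (\<Sum>j\<in>A. D i (f j))"
  by (induction A rule: infinite_finite_induct) (simp_all add: D_add)

lemma D_act: "D i (act p x) = act p (D i x) + act (pd i p) x"
proof (induction p arbitrary: x rule: mpol_induct)
  case (Cst c)
  show ?case by (simp add: D_sc)
next
  case (Var j)
  show ?case by (simp add: D_X pd_Var)
next
  case (add p q)
  show ?case by (simp add: act_add add D_add pd_add)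
next
  case (mult p q)
  show ?case by (simp add: act_mult mult act_add act_add_right pd_mult act_commute[of "pd i p" q] add_ac)
qed

definition Dir :: "('n \<Rightarrow> 'k) \<Rightarrow> 'm \<Rightarrow> 'm" where
  "Dir w x = (\<Sum>i\<in>UNIV. sc (w i) (D i x))"

lemma Dir_add: "Dir w (x + y) = Dir w x + Dir w y"
  by (simp add: Dir_def D_add sc_add_right sum.distrib)

lemma Dir_zero [simp]: "Dir w 0 = 0"
  by (simp add: Dir_def)

lemma Dir_minus: "Dir w (- x) = - Dir w x"
  using Dir_add[of w x "- x"] by (simp add: eq_neg_iff_add_eq_0 add.commute)

lemma Dir_diff: "Dir w (x - y) = Dir w x - Dir w y"
  using Dir_add[of w x "- y"] by (simp add: Dir_minus)

lemma D_Dir: "D i (Dir w x) = Dir w (D i x)"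
  by (simp add: Dir_def D_sum D_sc D_commute[of i])

lemma Dir_sc: "Dir w (sc a x) = sc a (Dir w x)"
  by (simp add: Dir_def D_sc sc_sum sc_sc mult.commute)

lemma act_dird: "act (dird w p) x = (\<Sum>i\<in>UNIV. sc (w i) (act (pd i p) x))"
proof -
  have "act (sum f A) x = (\<Sum>i\<in>A. act (f i) x)" for f :: "'n \<Rightarrow> ('n, 'k) mpol" and A
    by (induction A rule: infinite_finite_induct) (simp_all add: act_add)
  then show ?thesis by (simp add: dird_def act_mult)
qed

lemma Dir_act: "Dir w (act p x) = act p (Dir w x) + act (dird w p) x"
proof -
  have "act p (sum f A) = (\<Sum>i\<in>A. act p (f i))" for f :: "'n \<Rightarrow> 'm" and A
    by (induction A rule: infinite_finite_induct) (simp_all add: act_add_right)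
  then show ?thesis
    by (simp add: Dir_def D_act sc_add_right sum.distrib act_dird act_sc)
qed

text \<open>The property passes from y to D_i y: by the Leibniz rule, f^(t+1) D_i y is D_i (f^(t+1)
  y) minus a multiple of f^t y. The other closure operations of the filtration preserve it as
  well.\<close>

lemma power_torsion:
  assumes gen: "(\<Union>k. bern_filt sc X D G k) = UNIV" and f: "\<And>g. g \<in> G \<Longrightarrow> act f g = 0"
  shows "\<exists>t. act (f ^ t) x = 0"
proof -
  have mono: "act (f ^ t) x = 0" if "act (f ^ s) x = 0" "s \<le> t" for s t x
  proof -
    have "f ^ t = f ^ (t - s) * f ^ s" using that(2) by (simp flip: power_add)
    then show ?thesis using that(1) by (simp add: act_mult)
  qed
  have span: "\<exists>t. act (f ^ t) x = 0"
    if "x \<in> kspan sc A" and "\<And>y. y \<in> A \<Longrightarrow> \<exists>t. act (f ^ t) y = 0" for A x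
    using that(1)
  proof induction
    case (kspan_add v w)
    then obtain s t where "act (f ^ s) v = 0" "act (f ^ t) w = 0" by blast
    then show ?case
      using mono[of s v "max s t"] mono[of t w "max s t"]
      by (intro exI[of _ "max s t"]) (simp add: act_add_right)
  next
    case (kspan_smult v c)
    then obtain t where "act (f ^ t) v = 0" by blast
    then show ?case by (intro exI[of _ t]) (simp add: act_sc)
  qed (use that(2) in auto)
  have "\<exists>t. act (f ^ t) x = 0" if "x \<in> bern_filt sc X D G k" for x k
    using that
  proof (induction k arbitrary: x)
    case 0
    show ?case
      by (rule span[of _ G]) (use 0 f in \<open>auto intro!: exI[of _ 1]\<close>)
  next
    case (Suc k)
    have X: "\<exists>t. act (f ^ t) (X i y) = 0" if "y \<in> bern_filt sc X D G k" for i y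
    proof -
      obtain t where "act (f ^ t) y = 0" using Suc.IH \<open>y \<in> bern_filt sc X D G k\<close> by blast
      then have "act (f ^ t) (act (Var i) y) = 0"
        by (subst act_commute) (simp only: act_zero_right)
      then show ?thesis by auto
    qed
    have D: "\<exists>t. act (f ^ t) (D i y) = 0" if "y \<in> bern_filt sc X D G k" for i y
    proof -
      obtain t where t: "act (f ^ t) y = 0" using Suc.IH \<open>y \<in> bern_filt sc X D G k\<close> by blast
      \<comment> \<open>A derivative of a power keeps all but one of the factors
        \<open>f\<close>.\<close>
      have "\<exists>r. pd i (f ^ Suc t) = r * f ^ t" for t
      proof (induction t)
        case 0
        show ?case by simp
      next
        case (Suc t)
        then obtain r where r: "pd i (f ^ Suc t) = r * f ^ t" by blast
        have "pd i (f ^ Suc (Suc t)) = pd i f * f ^ Suc t + f * pd i (f ^ Suc t)"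
          by (simp only: power_Suc[of f "Suc t"] pd_mult)
        also have "\<dots> = (pd i f + r) * f ^ Suc t"
          unfolding r by (simp add: algebra_simps)
        finally show ?case by blast
      qed
      then obtain r where r: "pd i (f ^ Suc t) = r * f ^ t" by blast
      have "act (f ^ Suc t) y = 0" using t mono[of t y "Suc t"] by simp
      then have "act (f ^ Suc t) (D i y) + act r (act (f ^ t) y) = 0"
        using D_act[of i "f ^ Suc t" y] unfolding r act_mult[of r] by simp
      then have "act (f ^ Suc t) (D i y) = 0"
        unfolding t by simp
      then show ?thesis by blast
    qed
    show ?case
      using Suc.prems unfolding bern_filt.simps by (rule span) (use X D Suc.IH in blast)
  qed
  then show ?thesis using gen by blast
qed

section \<open>Regularity of monic directions\<close>

text \<open>The sum of the images of the directions. Statements about the quotient of M by it are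
  phrased as membership, so the quotient is never formed.\<close>

fun dir_images :: "('n \<Rightarrow> 'k) list \<Rightarrow> 'm set" where
  "dir_images [] = {0}"
| "dir_images (w # ws) = {Dir w x + y |x y. y \<in> dir_images ws}"

lemma dir_images_ConsI: "y \<in> dir_images ws \<Longrightarrow> Dir w x + y \<in> dir_images (w # ws)"
  by auto

lemma dir_images_zero: "0 \<in> dir_images ws"
proof (induction ws)
  case (Cons w ws)
  then show ?case using dir_images_ConsI[of 0 ws w 0] by simp
qed simp

lemma dir_images_add: "x \<in> dir_images ws \<Longrightarrow> y \<in> dir_images ws \<Longrightarrow> x + y \<in> dir_images ws"
proof (induction ws arbitrary: x y)
  case (Cons w ws)
  then obtain x1 x2 y1 y2 where "x2 \<in> dir_images ws" "y2 \<in> dir_images ws"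
    "x = Dir w x1 + x2" "y = Dir w y1 + y2" by auto
  then have "x + y = Dir w (x1 + y1) + (x2 + y2)" "x2 + y2 \<in> dir_images ws"
    using Cons.IH by (simp_all add: Dir_add)
  then show ?case by (metis dir_images_ConsI)
qed simp

text \<open>Applied to scalars, to \<open>D i\<close> and to polynomials constant along
  \<open>ws\<close>; all of these commute with the directions concerned.\<close>

lemma dir_images_closed:
  assumes "\<And>x y. T (x + y) = T x + T y" "\<And>w x. w \<in> set ws \<Longrightarrow> T (Dir w x) = Dir w (T x)"
    "x \<in> dir_images ws"
  shows "T x \<in> dir_images ws"
  using assms(2,3)
proof (induction ws arbitrary: x)
  case Nil
  then show ?case using assms(1)[of 0 0] by simp
next
  case (Cons w ws)
  then obtain y z where "z \<in> dir_images ws" "x = Dir w y + z" by auto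
  then have "T x = Dir w (T y) + T z" "T z \<in> dir_images ws"
    using Cons by (simp_all add: assms(1))
  then show ?case by (metis dir_images_ConsI)
qed

lemma dir_images_sc: "x \<in> dir_images ws \<Longrightarrow> sc a x \<in> dir_images ws"
  by (rule dir_images_closed) (simp_all add: sc_add_right Dir_sc)

lemma dir_images_minus: "x \<in> dir_images ws \<Longrightarrow> - x \<in> dir_images ws"
  using dir_images_sc[of x ws "- 1"] by simp

lemma dir_images_diff: "x \<in> dir_images ws \<Longrightarrow> y \<in> dir_images ws \<Longrightarrow> x - y \<in> dir_images ws"
  using dir_images_add[of x ws "- y"] dir_images_minus[of y ws] by simp

lemma dir_images_D: "x \<in> dir_images ws \<Longrightarrow> D i x \<in> dir_images ws"
  by (rule dir_images_closed) (simp_all add: D_add D_Dir)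

lemma dir_images_sum: "(\<And>i. i \<in> A \<Longrightarrow> f i \<in> dir_images ws) \<Longrightarrow> sum f A \<in> dir_images ws"
  by (induction A rule: infinite_finite_induct) (simp_all add: dir_images_zero dir_images_add)

lemma dir_images_Dir: "x \<in> dir_images ws \<Longrightarrow> Dir w x \<in> dir_images ws"
  unfolding Dir_def by (intro dir_images_sum dir_images_sc dir_images_D)

lemma dir_images_act: "p \<in> dconst ws \<Longrightarrow> x \<in> dir_images ws \<Longrightarrow> act p x \<in> dir_images ws"
  by (rule dir_images_closed) (simp_all add: act_add_right Dir_act dconst_def)

text \<open>If D x lies in the submodule N and g x = 0, then so do g' x, g'' x, and so on, until
  the derivative of g is a nonzero constant.\<close>

lemma monic_dir_regular:
  assumes "monic_dirs I (w # ws)" and tors: "\<And>f x. f \<in> I \<Longrightarrow> \<exists>t. act (f ^ t) x = 0"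
    and x: "Dir w x \<in> dir_images ws"
  shows "x \<in> dir_images ws"
proof -
  from assms(1) obtain f e c where f: "f \<in> I" "f \<in> dconst ws" and c: "c \<noteq> 0" "(dird w ^^ e) f = Cst c"
    by auto
  obtain t where t: "act (f ^ t) x = 0" using tors[OF f(1)] by blast
  \<comment> \<open>The power \<open>f ^ t\<close> that kills \<open>x\<close> is differentiated
    \<open>t * e\<close> times, down to a nonzero constant.\<close>
  obtain d where d: "d \<noteq> 0" "(dird w ^^ (t * e)) (f ^ t) = Cst d"
    using dird_pow_power_Cst[OF c(2,1)] by blast
  have "act ((dird w ^^ k) (f ^ t)) x \<in> dir_images ws" for k
  proof (induction k)
    case 0
    then show ?case using t dir_images_zero by simp
  next
    case (Suc k)
    let ?g = "(dird w ^^ k) (f ^ t)"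
    have "act ?g (Dir w x) \<in> dir_images ws"
      by (intro dir_images_act dconst_dird_pow dconst_power f x)
    moreover have "Dir w (act ?g x) \<in> dir_images ws"
      by (intro dir_images_Dir Suc.IH)
    moreover have "act ((dird w ^^ Suc k) (f ^ t)) x = Dir w (act ?g x) - act ?g (Dir w x)"
      by (simp add: Dir_act)
    ultimately show ?case by (simp only: dir_images_diff)
  qed
  from this[of "t * e"] have "sc d x \<in> dir_images ws" by (simp add: d)
  then have "sc (1 / d) (sc d x) \<in> dir_images ws" by (rule dir_images_sc)
  then show ?thesis using d(1) by (simp add: sc_sc)
qed

text \<open>An M-regular sequence read from the end of the list, each direction being injective
  modulo the images of those after it.\<close>

fun regular_dirs :: "('n \<Rightarrow> 'k) list \<Rightarrow> bool" where
  "regular_dirs [] \<longleftrightarrow> True"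
| "regular_dirs (w # ws) \<longleftrightarrow> regular_dirs ws \<and> (\<forall>x. Dir w x \<in> dir_images ws \<longrightarrow> x \<in> dir_images ws)"

lemma regular_dirs_appendD: "regular_dirs (us @ ws) \<Longrightarrow> regular_dirs ws"
  by (induction us) simp_all

lemma monic_dirs_regular:
  assumes "\<And>f x. f \<in> I \<Longrightarrow> \<exists>t. act (f ^ t) x = 0" "monic_dirs I ws"
  shows "regular_dirs ws"
  using assms(2)
proof (induction ws)
  case (Cons w ws)
  then show ?case using monic_dir_regular[OF Cons.prems assms(1)] by auto
qed simp

section \<open>The De Rham complex\<close>

text \<open>The sign picked up when e_j is moved from the front to its place in the exterior
  monomial indexed by \<open>J\<close>.\<close>

definition sg :: "'n \<Rightarrow> 'n set \<Rightarrow> 'm \<Rightarrow> 'm" where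
  "sg j J x = (if even (card {l\<in>J. l < j}) then x else - x)"

abbreviation d :: "('n set \<Rightarrow> 'm) \<Rightarrow> 'n set \<Rightarrow> 'm" where
  "d \<equiv> dR_diff D"

lemma d_sg: "d \<omega> J = (\<Sum>j\<in>J. sg j J (D j (\<omega> (J - {j}))))"
  by (simp add: dR_diff_def sg_def)

lemma sg_add: "sg j J (x + y) = sg j J x + sg j J y"
  and sg_sg: "sg j J (sg j J x) = x"
  and sg_zero [simp]: "sg j J 0 = 0"
  and D_sg: "D i (sg j J x) = sg j J (D i x)"
  and sc_sg: "sc a (sg j J x) = sg j J (sc a x)"
  by (simp_all add: sg_def D_minus sc_minus)

lemma sg_sum: "sg j J (sum f A) = (\<Sum>i\<in>A. sg j J (f i))"
  by (induction A rule: infinite_finite_induct) (simp_all add: sg_add)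

lemma sg_insert_self: "sg j (insert j J) x = sg j J x"
proof -
  have "{l \<in> insert j J. l < j} = {l \<in> J. l < j}" by auto
  then show ?thesis by (simp add: sg_def)
qed

text \<open>The anticommutation of e_j and e_k: passing from one order to the other changes exactly
  one of the two counts, by one.\<close>

lemma sg_exchange:
  assumes "k \<in> J" "j \<notin> J"
  shows "sg k J (sg j (J - {k}) x) = - sg j J (sg k (insert j J) x)"
proof -
  have "j \<noteq> k" using assms by blast
  then consider "j < k" | "k < j" by fastforce
  then show ?thesis
  proof cases
    case 1
    have "{l \<in> J - {k}. l < j} = {l \<in> J. l < j}" using 1 by auto
    moreover have "{l \<in> insert j J. l < k} = insert j {l \<in> J. l < k}" using 1 by auto
    ultimately show ?thesis using assms(2) by (simp add: sg_def)
  next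
    case 2
    have "{l \<in> J. l < j} = insert k {l \<in> J - {k}. l < j}" using 2 assms(1) by auto
    moreover have "{l \<in> insert j J. l < k} = {l \<in> J. l < k}" using 2 by auto
    ultimately show ?thesis by (simp add: sg_def)
  qed
qed

lemma d_add: "d (\<lambda>J. \<omega> J + \<eta> J) J = d \<omega> J + d \<eta> J"
  by (simp add: d_sg D_add sg_add sum.distrib)

lemma d_diff: "d (\<lambda>J. \<omega> J - \<eta> J) J = d \<omega> J - d \<eta> J"
proof -
  have "sg j J (x - y) = sg j J x - sg j J y" for j x y
    by (simp add: sg_def)
  then show ?thesis by (simp add: d_sg D_diff sum_subtractf)
qed

lemma d_zero [simp]: "d (\<lambda>_. 0) J = 0"
  by (simp add: d_sg)

lemma d_sc: "d (\<lambda>J. sc a (\<omega> J)) J = sc a (d \<omega> J)"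
  by (simp add: d_sg D_sc sc_sum sc_sg)

lemma d_D: "d (\<lambda>J. D i (\<omega> J)) J = D i (d \<omega> J)"
  by (simp add: d_sg D_sum D_sg D_commute[of i])

lemma d_sum: "d (\<lambda>J. \<Sum>i\<in>A. F i J) J = (\<Sum>i\<in>A. d (F i) J)"
  by (induction A rule: infinite_finite_induct) (simp_all add: d_add)

lemma d_Dir: "d (\<lambda>J. Dir w (\<omega> J)) J = Dir w (d \<omega> J)"
  by (simp add: Dir_def d_sum d_sc d_D)

lemma dir_images_d: "(\<And>J. \<omega> J \<in> dir_images ws) \<Longrightarrow> d \<omega> J \<in> dir_images ws"
  unfolding d_sg sg_def by (intro dir_images_sum) (simp add: dir_images_D dir_images_minus)

lemma cochain_d: "cochain i \<omega> \<Longrightarrow> cochain (Suc i) (d \<omega>)"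
  unfolding cochain_def d_sg
proof (intro allI impI sum.neutral ballI)
  fix J :: "'n set" and j
  assume "\<forall>J. card J \<noteq> i \<longrightarrow> \<omega> J = 0" "card J \<noteq> Suc i" "j \<in> J"
  then have "\<omega> (J - {j}) = 0" by (metis Suc_pred card_Diff_singleton card_gt_0_iff empty_iff finite
        One_nat_def diff_Suc_1)
  then show "sg j J (D j (\<omega> (J - {j}))) = 0" by simp
qed

section \<open>Contraction with a direction and the homotopy formula\<close>

definition contract1 :: "'n \<Rightarrow> ('n set \<Rightarrow> 'm) \<Rightarrow> 'n set \<Rightarrow> 'm" where
  "contract1 j \<omega> J = (if j \<in> J then 0 else sg j J (\<omega> (insert j J)))"

definition contract :: "('n \<Rightarrow> 'k) \<Rightarrow> ('n set \<Rightarrow> 'm) \<Rightarrow> 'n set \<Rightarrow> 'm" where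
  "contract w \<omega> J = (\<Sum>j\<in>UNIV. sc (w j) (contract1 j \<omega> J))"

text \<open>Cartan's formula. For j \<in> J the second summand is zero and only k = j survives in
  the first. For j \<notin> J the terms with k \<noteq> j cancel by
  \<open>sg_exchange\<close>.\<close>

lemma homotopy1: "d (contract1 j \<omega>) J + contract1 j (d \<omega>) J = D j (\<omega> J)"
proof (cases "j \<in> J")
  case True
  have "d (contract1 j \<omega>) J = (\<Sum>k\<in>J. if k = j then D j (\<omega> J) else 0)"
    unfolding d_sg
  proof (intro sum.cong refl)
    fix k assume "k \<in> J"
    show "sg k J (D k (contract1 j \<omega> (J - {k}))) = (if k = j then D j (\<omega> J) else 0)"
    proof (cases "k = j")
      case eq: True
      have "sg j (J - {j}) x = sg j J x" for x
        using sg_insert_self[of j "J - {j}" x] True by (simp add: insert_absorb)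
      then show ?thesis using eq True by (simp add: contract1_def D_sg sg_sg insert_absorb)
    next
      case False
      then show ?thesis using True by (simp add: contract1_def)
    qed
  qed
  then show ?thesis using True by (simp add: contract1_def)
next
  case False
  have "contract1 j (d \<omega>) J = sg j J (\<Sum>k\<in>insert j J. sg k (insert j J) (D k (\<omega> (insert j J - {k}))))"
    using False by (simp add: contract1_def d_sg)
  also have "\<dots> = sg j J (sg j J (D j (\<omega> J)))
      + (\<Sum>k\<in>J. sg j J (sg k (insert j J) (D k (\<omega> (insert j J - {k})))))"
    using False by (simp add: sg_add sg_sum sg_insert_self)
  also have "(\<Sum>k\<in>J. sg j J (sg k (insert j J) (D k (\<omega> (insert j J - {k}))))) = - d (contract1 j \<omega>) J"
    unfolding d_sg sum_negf[symmetric]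
  proof (intro sum.cong refl)
    fix k assume k: "k \<in> J"
    have "insert j J - {k} = insert j (J - {k})" using k False by auto
    then show "sg j J (sg k (insert j J) (D k (\<omega> (insert j J - {k}))))
        = - sg k J (D k (contract1 j \<omega> (J - {k})))"
      using k False sg_exchange[OF k False] by (simp add: contract1_def D_sg)
  qed
  finally show ?thesis by (simp add: sg_sg)
qed

lemma homotopy: "d (contract w \<omega>) J + contract w (d \<omega>) J = Dir w (\<omega> J)"
proof -
  have "d (contract w \<omega>) J + contract w (d \<omega>) J
    = (\<Sum>j\<in>UNIV. sc (w j) (d (contract1 j \<omega>) J + contract1 j (d \<omega>) J))"
    unfolding contract_def[abs_def] by (simp add: d_sum d_sc sc_add_right sum.distrib)
  then show ?thesis by (simp add: homotopy1 Dir_def)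
qed

text \<open>By the homotopy formula, d d commutes with contractions, which reduce the index set to
  the empty one.\<close>

lemma d_d: "d (d \<omega>) J = 0"
proof -
  have "finite J" by simp
  then show ?thesis
  proof (induction J arbitrary: \<omega> rule: finite_induct)
    case empty
    show ?case by (simp add: d_sg)
  next
    case (insert j J)
    have "contract1 j (d (d \<omega>)) J = D j (d \<omega> J) - d (contract1 j (d \<omega>)) J"
      using homotopy1[of j "d \<omega>" J] by (simp add: algebra_simps)
    also have "contract1 j (d \<omega>) = (\<lambda>J. D j (\<omega> J) - d (contract1 j \<omega>) J)"
      using homotopy1[of j \<omega>] by (auto simp: fun_eq_iff algebra_simps)
    also have "d \<dots> J = D j (d \<omega> J)"
      using insert.IH by (simp add: d_diff d_D)
    finally have "sg j J (sg j J (d (d \<omega>) (insert j J))) = sg j J 0"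
      using insert.hyps by (simp add: contract1_def)
    then show ?case by (simp add: sg_sg)
  qed
qed

lemma cochain_contract:
  assumes "cochain (Suc i) \<omega>"
  shows "cochain i (contract w \<omega>)"
  unfolding cochain_def contract_def
proof (intro allI impI sum.neutral ballI)
  fix J :: "'n set" and j
  assume "card J \<noteq> i"
  then have "contract1 j \<omega> J = 0"
    using assms by (simp add: contract1_def cochain_def)
  then show "sc (w j) (contract1 j \<omega> J) = 0" by simp
qed

lemma contract_0_cochain: "cochain 0 \<omega> \<Longrightarrow> contract w \<omega> = (\<lambda>_. 0)"
  by (intro ext) (auto simp: contract_def contract1_def cochain_def intro!: sum.neutral)

lemma dir_images_contract: "(\<And>J. \<omega> J \<in> dir_images ws) \<Longrightarrow> contract w \<omega> J \<in> dir_images ws"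
  unfolding contract_def contract1_def sg_def
  by (intro dir_images_sum dir_images_sc) (simp add: dir_images_zero dir_images_minus)

text \<open>The induction runs over the cohomology of the quotients by dir_images ws, with cochains
  kept in the module itself.\<close>

lemma regular_dirs_cohomology:
  assumes "regular_dirs (us @ ws)" "i < length us" "cochain i \<omega>" "\<And>J. d \<omega> J \<in> dir_images ws"
  shows "\<exists>\<eta>. (if i = 0 then \<eta> = (\<lambda>_. 0) else cochain (i - 1) \<eta>) \<and> (\<forall>J. \<omega> J - d \<eta> J \<in> dir_images ws)"
  using assms
\<comment> \<open>The last direction of \<open>us\<close> passes to the front of \<open>ws\<close>:
  it is injective modulo \<open>dir_images ws\<close>, and the induction hypothesis is used one
  degree lower modulo its image.\<close>
proof (induction us arbitrary: ws i \<omega> rule: rev_induct)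
  case Nil
  then show ?case by simp
next
  case (snoc w us)
  have reg: "x \<in> dir_images ws" if "Dir w x \<in> dir_images ws" for x
    using that regular_dirs_appendD[of us "w # ws"] snoc.prems(1) by simp
  have c: "contract w (d \<omega>) J \<in> dir_images ws" for J
    by (intro dir_images_contract snoc.prems)
  show ?case
  proof (cases i)
    case 0
    have "Dir w (\<omega> J) \<in> dir_images ws" for J
      using c[of J] homotopy[of w \<omega> J] contract_0_cochain[of \<omega> w] snoc.prems(3) by (simp add: 0)
    then show ?thesis using reg 0 by (intro exI[of _ "\<lambda>_. 0"]) simp
  next
    case (Suc i')
    let ?\<kappa> = "contract w \<omega>"
    have \<kappa>: "cochain i' ?\<kappa>" using snoc.prems(3) Suc by (simp add: cochain_contract)
    \<comment> \<open>By the homotopy formula, \<kappa> is a cocycle modulo the larger sum of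
      images.\<close>
    have "d ?\<kappa> J \<in> dir_images (w # ws)" for J
    proof -
      have "d ?\<kappa> J = Dir w (\<omega> J) + - contract w (d \<omega>) J"
        using homotopy[of w \<omega> J] by (simp add: algebra_simps)
      then show ?thesis using dir_images_ConsI[OF dir_images_minus[OF c[of J]]] by metis
    qed
    then obtain \<eta> where \<eta>: "if i' = 0 then \<eta> = (\<lambda>_. 0) else cochain (i' - 1) \<eta>"
      "\<And>J. ?\<kappa> J - d \<eta> J \<in> dir_images (w # ws)"
      using snoc.IH[of "w # ws" i' ?\<kappa>] snoc.prems(1,2) \<kappa> Suc by auto
    have d\<eta>: "cochain i' (d \<eta>)"
    proof (cases i')
      case 0
      then show ?thesis using \<eta>(1) by (simp add: cochain_def)
    next
      case Suc
      then show ?thesis using \<eta>(1) cochain_d by fastforce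
    qed
    \<comment> \<open>Choosing \<open>x\<close> to be 0 outside degree \<open>i'\<close> makes the
      chosen family \<theta> a cochain.\<close>
    have "\<exists>x y. ?\<kappa> J - d \<eta> J = Dir w x + y \<and> y \<in> dir_images ws \<and> (card J \<noteq> i' \<longrightarrow> x = 0)" for J
    proof (cases "card J = i'")
      case True
      then show ?thesis using \<eta>(2)[of J] by auto
    next
      case False
      then have "?\<kappa> J = 0" "d \<eta> J = 0" using \<kappa> d\<eta> by (simp_all add: cochain_def)
      then show ?thesis using dir_images_zero by (intro exI[of _ 0]) simp
    qed
    then obtain \<theta> \<nu> where \<theta>: "\<And>J. ?\<kappa> J - d \<eta> J = Dir w (\<theta> J) + \<nu> J" "\<And>J. \<nu> J \<in> dir_images ws"
      "\<And>J. card J \<noteq> i' \<Longrightarrow> \<theta> J = 0"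
      by metis
    \<comment> \<open>Applying d to the decomposition of \<kappa> removes d \<eta>; comparison with
      the homotopy formula puts the \<open>w\<close>-derivative of \<omega> - d \<theta> into
      \<open>dir_images ws\<close>, and regularity of \<open>w\<close> finishes.\<close>
    have "\<omega> J - d \<theta> J \<in> dir_images ws" for J
    proof (rule reg)
      have \<kappa>_eq: "?\<kappa> = (\<lambda>J. d \<eta> J + (Dir w (\<theta> J) + \<nu> J))"
        using \<theta>(1) by (auto simp: fun_eq_iff algebra_simps)
      have "d ?\<kappa> J = Dir w (d \<theta> J) + d \<nu> J"
        unfolding \<kappa>_eq by (simp add: d_add d_d d_Dir)
      then have "Dir w (\<omega> J - d \<theta> J) = contract w (d \<omega>) J + d \<nu> J"
        using homotopy[of w \<omega> J] by (simp add: Dir_diff algebra_simps)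
      also have "\<dots> \<in> dir_images ws"
        by (intro dir_images_add c dir_images_d \<theta>)
      finally show "Dir w (\<omega> J - d \<theta> J) \<in> dir_images ws" .
    qed
    moreover have "cochain (i - 1) \<theta>" using \<theta>(3) Suc by (simp add: cochain_def)
    ultimately show ?thesis using Suc by (intro exI[of _ \<theta>]) simp
  qed
qed

lemma regular_dirs_deRham_vanishes:
  assumes "regular_dirs ws" "i < length ws"
  shows "deRham_vanishes D i"
  unfolding deRham_vanishes_def
proof (intro allI impI)
  fix \<omega> :: "'n set \<Rightarrow> 'm"
  assume \<omega>: "cochain i \<omega> \<and> d \<omega> = (\<lambda>_. 0)"
  have "\<exists>\<eta>. (if i = 0 then \<eta> = (\<lambda>_. 0) else cochain (i - 1) \<eta>) \<and> (\<forall>J. \<omega> J - d \<eta> J \<in> dir_images [])"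
    by (rule regular_dirs_cohomology[of ws]) (use assms \<omega> in auto)
  then obtain \<eta> where \<eta>: "if i = 0 then \<eta> = (\<lambda>_. 0) else cochain (i - 1) \<eta>" "\<And>J. \<omega> J = d \<eta> J"
    by auto
  then show "if i = 0 then \<omega> = (\<lambda>_. 0) else \<exists>\<eta>. cochain (i - 1) \<eta> \<and> d \<eta> = \<omega>"
    by (cases "i = 0") (auto intro!: exI[of _ \<eta>])
qed

section \<open>The support\<close>

text \<open>If every generator were killed by some element outside \<open>P\<close>, the product of
  these finitely many elements would lie in the annihilator but not in \<open>P\<close>.\<close>

lemma prime_over_annihilator_in_support:
  assumes "finite G" "prime_ideal P" "{f. \<forall>g\<in>G. act f g = 0} \<subseteq> P"
  shows "P \<in> R_support sc X"
proof (rule ccontr)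
  assume "P \<notin> R_support sc X"
  then have *: "\<exists>s. s \<notin> P \<and> act s m = 0" for m
    using assms(2) unfolding R_support_def by blast
  have "\<exists>s. s \<notin> P \<and> (\<forall>g\<in>G. act s g = 0)"
    using assms(1)
  proof induction
    case empty
    then show ?case using prime_ideal_one[OF assms(2)] by blast
  next
    case (insert g G)
    then obtain s where s: "s \<notin> P" "\<forall>g\<in>G. act s g = 0" by blast
    obtain r where r: "r \<notin> P" "act r g = 0" using * by blast
    have "act (s * r) h = 0" if "h \<in> insert g G" for h
      using that s(2) r(2) act_commute[of s r h] by (auto simp: act_mult)
    moreover have "s * r \<notin> P" using s(1) r(1) prime_idealD[OF assms(2)] by blast
    ultimately show ?case by blast
  qed
  then show False using assms(3) by blast
qed

lemma supp_dim_ge: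
  assumes "finite G" "length cs = Suc t" "sorted_wrt (\<subset>) cs"
    "\<forall>P\<in>set cs. prime_ideal P \<and> {f. \<forall>g\<in>G. act f g = 0} \<subseteq> P"
  shows "ereal (real t) \<le> supp_dim sc X"
proof -
  have sub: "set cs \<subseteq> R_support sc X"
    using assms(4) prime_over_annihilator_in_support[OF assms(1)] by blast
  have ne: "cs \<noteq> []" using assms(2) by auto
  then have "R_support sc X \<noteq> {}" using sub by fastforce
  moreover have "ereal (real t) = ereal (real (length cs) - 1)" using assms(2) by simp
  then have "ereal (real t) \<in> {ereal (real (length cs) - 1) | cs. cs \<noteq> [] \<and>
      set cs \<subseteq> R_support sc X \<and> sorted_wrt (\<lambda>A B. A \<subset> B) cs}"
    using sub ne assms(3) by blast
  ultimately show ?thesis by (simp add: supp_dim_def Sup_upper)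
qed

lemma is_ideal_annihilator: "is_ideal {f. \<forall>g\<in>G. act f g = 0}"
  by (simp add: is_ideal_def act_add act_mult)

text \<open>It suffices to find more than \<open>i\<close> monic directions for the annihilator of
  \<open>G\<close>, since they form a regular sequence.\<close>

lemma deRham_vanishes_below_codim:
  assumes G: "finite G" "(\<Union>k. bern_filt sc X D G k) = UNIV"
    and i: "ereal (real i) < ereal (real (card (UNIV :: 'n set))) - supp_dim sc X"
  shows "deRham_vanishes D i"
proof (cases "\<forall>x::'m. x = 0")
  \<comment> \<open>The zero module is treated apart: its support is empty and its dimension is
    -\<infinity>.\<close>
  case True
  then have "\<omega> = \<eta>" for \<omega> \<eta> :: "'n set \<Rightarrow> 'm" by (metis ext)
  then show ?thesis unfolding deRham_vanishes_def cochain_def by (metis True)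
next
  case False
  define I where "I = {f. \<forall>g\<in>G. act f g = 0}"
  let ?n = "card (UNIV :: 'n set)"
  have I: "is_ideal I" unfolding I_def by (rule is_ideal_annihilator)
  have tors: "\<exists>t. act (f ^ t) x = 0" if "f \<in> I" for f x
    using that by (intro power_torsion[OF G(2)]) (simp add: I_def)
  have one: "1 \<notin> I" using tors[of 1] False by auto
  obtain ws where ws: "monic_dirs I ws" "i < length ws"
  proof -
    consider ws where "length ws = ?n" "monic_dirs I ws"
      | ws where "length ws < ?n" "monic_dirs I ws" "I \<inter> dconst ws \<subseteq> {0}"
      using ex_monic_dirs[of ?n I] by blast
    then show thesis
    proof cases
      case (1 ws)
      \<comment> \<open>With all n directions found, only i < n is left to show. A prime over the
        proper ideal \<open>I\<close> lies in the support, so the dimension is at least 0.\<close>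
      obtain P where "prime_ideal P" "I \<subseteq> P"
        using ex_prime_ideal_disjoint[OF I, of "{1}"] one by auto
      then have "ereal (real 0) \<le> supp_dim sc X"
        by (intro supp_dim_ge[OF G(1), of "[P]"]) (simp_all add: I_def)
      then have "ereal (real ?n) - supp_dim sc X \<le> ereal (real ?n) - ereal (real 0)"
        by (intro ereal_minus_mono) simp_all
      with i have "ereal (real i) < ereal (real ?n) - ereal (real 0)" by (rule less_le_trans)
      then have "i < length ws" using 1 by simp
      then show thesis using that 1 by blast
    next
      case (2 ws)
      \<comment> \<open>A chain of \<open>t + 1\<close> primes in the support bounds the dimension
        below by n - \<open>length ws\<close>, hence i < \<open>length ws\<close>.\<close>
      define t where "t = ?n - length ws"
      obtain cs where "length cs = Suc t" "sorted_wrt (\<subset>) cs" "\<forall>P\<in>set cs. prime_ideal P \<and> I \<subseteq> P"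
        using ex_prime_chain[OF I 2(2,3), of t] 2(1) by (auto simp: t_def)
      then have "ereal (real t) \<le> supp_dim sc X"
        by (intro supp_dim_ge[OF G(1), of cs]) (simp_all add: I_def)
      then have "ereal (real ?n) - supp_dim sc X \<le> ereal (real ?n) - ereal (real t)"
        by (intro ereal_minus_mono) simp_all
      with i have "ereal (real i) < ereal (real ?n) - ereal (real t)" by (rule less_le_trans)
      then have "i < length ws" using 2(1) by (simp add: t_def of_nat_diff)
      then show thesis using that 2 by blast
    qed
  qed
  show ?thesis
    using monic_dirs_regular[OF tors ws(1)] ws(2) by (rule regular_dirs_deRham_vanishes)
qed

end

theorem theorem3:
  fixes sc :: "'k::field_char_0 \<Rightarrow> 'm::ab_group_add \<Rightarrow> 'm"
    and X D :: "'n::{finite,linorder} \<Rightarrow> 'm \<Rightarrow> 'm"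
  assumes "holonomic sc X D"
  shows "\<forall>i::nat. ereal (real i) < ereal (real (card (UNIV :: 'n set))) - supp_dim sc X
           \<longrightarrow> deRham_vanishes D i"
proof -
  from assms have W: "weyl_module sc X D" by (simp add: holonomic_def)
  have DX: "D i (X j x) = X j (D i x) + (if i = j then x else 0)" for i j x
  proof -
    have "D i (X j x) - X j (D i x) = (if i = j then x else 0)"
      using W unfolding weyl_module_def by blast
    then show ?thesis by (metis add.commute diff_add_cancel)
  qed
  interpret weyl_operators sc X D
    by unfold_locales (use W DX in \<open>unfold weyl_module_def, blast\<close>)+
  from assms obtain G where "finite G" "(\<Union>k. bern_filt sc X D G k) = UNIV"
    unfolding holonomic_def by blast
  then show ?thesis using deRham_vanishes_below_codim by blast
qed

end
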